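(* In the setting described in the context, assume that the number of active senders $l$ is given as $l_n=\frac{n}{t_n}$ and satisfies $\frac{l_n}{n}\to 0$ as $n\to\infty$. Assume also that $v_W$ belongs to the open set $\mathcal V\subset\mathbb R$. Then $$\inf_{v\in\mathcal V} d_V\big(P_{Z,M},\,G_v^n\times P_M\big)\to 0\quad\text{as } n\to\infty .$$
   Context: For each $n$ there are $l_n$ active senders with indices $i_1,\dots,i_{l_n}$, having binary messages $M=(M_{i_1},\dots,M_{i_{l_n}})$ with distribution $P_M$. The adversary Willie receives, for $j=1,\dots,n$, $$Z_j=N_{W,j}+\frac1{\sqrt n}\sum_{k=1}^{l_n}b_{i_k}(-1)^{M_{i_k}+S_{i_k,j}},$$ where the $N_{W,j}$ are independent Gaussian variables with mean $0$ and variance $v_W>0$, the $S_{i_k,j}$ are independent uniform variables on $\{0,1\}$ (secrets unknown to Willie), and $M$, the $S_{i_k,j}$ and the $N_{W,j}$ are independent of each other. The fading coefficients $b_{i_k}$ are positive constants with $\max_k b_{i_k}=\overline b$ and $\min_k b_{i_k}=\underline b$, where $\overline b\ge\underline b>0$, $v_W$ and $\mathcal V$ do not depend on $n$. $P_{Z,M}$ is the joint distribution of $Z=(Z_1,\dots,Z_n)$ and $M$; $G_v$ is the Gaussian distribution on $\mathbb R$ with mean $0$ and variance $v$, $G_v^n$ its $n$-fold product; $d_V(P,Q)=\frac12\|P-Q\|_1$ is the variational distance. *)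

theory Defs
  imports "HOL-Probability.Probability"
begin

(* The norm \<parallel>P - Q\<parallel>\<^sub>1 of the signed measure P - Q, i.e. its total variation. Intended for finite
   measures P, Q on the same measurable space; there the supremum is taken over a set bounded
   by P(space P) + Q(space P). *)
definition tv_norm_diff :: "'c measure \<Rightarrow> 'c measure \<Rightarrow> real" where
  "tv_norm_diff P Q =
     (SUP \<pi> \<in> {\<pi>. finite \<pi> \<and> \<pi> \<subseteq> sets P \<and> partition_on (space P) \<pi>}.
        \<Sum>B\<in>\<pi>. \<bar>measure P B - measure Q B\<bar>)"

definition variational_distance :: "'c measure \<Rightarrow> 'c measure \<Rightarrow> real" where
  "variational_distance P Q = 1 / 2 * tv_norm_diff P Q"

(* The second argument of normal_density is the standard deviation. Meaningful for v > 0 only. *)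
definition gaussian :: "real \<Rightarrow> real measure" where
  "gaussian v = density lborel (\<lambda>x. ennreal (normal_density 0 (sqrt v) x))"

definition gaussian_power :: "nat \<Rightarrow> real \<Rightarrow> (nat \<Rightarrow> real) measure" where
  "gaussian_power n v = (\<Pi>\<^sub>M j\<in>{1..n}. gaussian v)"

(* Message vectors are indexed by the set A of the indices of the active senders. *)
definition message_space :: "nat set \<Rightarrow> (nat \<Rightarrow> nat) measure" where
  "message_space A = (\<Pi>\<^sub>M i\<in>A. count_space {0, 1})"

definition received ::
  "nat \<Rightarrow> nat set \<Rightarrow> (nat \<Rightarrow> real) \<Rightarrow> ('a \<Rightarrow> nat \<Rightarrow> nat) \<Rightarrow> (nat \<Rightarrow> nat \<Rightarrow> 'a \<Rightarrow> nat) \<Rightarrow>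
   (nat \<Rightarrow> 'a \<Rightarrow> real) \<Rightarrow> nat \<Rightarrow> 'a \<Rightarrow> real" where
  "received n A b M S N j \<omega> =
     N j \<omega> + 1 / sqrt (real n) * (\<Sum>i\<in>A. b i * (-1) ^ (M \<omega> i + S i j \<omega>))"

definition message_law :: "'a measure \<Rightarrow> nat set \<Rightarrow> ('a \<Rightarrow> nat \<Rightarrow> nat) \<Rightarrow> (nat \<Rightarrow> nat) measure" where
  "message_law \<Omega> A M = distr \<Omega> (message_space A) M"

definition joint_law ::
  "'a measure \<Rightarrow> nat \<Rightarrow> nat set \<Rightarrow> (nat \<Rightarrow> real) \<Rightarrow> ('a \<Rightarrow> nat \<Rightarrow> nat) \<Rightarrow> (nat \<Rightarrow> nat \<Rightarrow> 'a \<Rightarrow> nat) \<Rightarrow>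
   (nat \<Rightarrow> 'a \<Rightarrow> real) \<Rightarrow> ((nat \<Rightarrow> real) \<times> (nat \<Rightarrow> nat)) measure" where
  "joint_law \<Omega> n A b M S N =
     distr \<Omega> ((\<Pi>\<^sub>M j\<in>{1..n}. borel) \<Otimes>\<^sub>M message_space A)
       (\<lambda>\<omega>. (\<lambda>j\<in>{1..n}. received n A b M S N j \<omega>, M \<omega>))"

datatype source = Message | Secret nat nat | Noise nat

(* The random variables have different types, so their independence is written out as
   independence of the generated families of events, which is what indep_vars unfolds to.
   The message vector is a single member of the family: its components may be dependent. *)
primrec source_events ::
  "'a measure \<Rightarrow> nat set \<Rightarrow> ('a \<Rightarrow> nat \<Rightarrow> nat) \<Rightarrow> (nat \<Rightarrow> nat \<Rightarrow> 'a \<Rightarrow> nat) \<Rightarrow>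
   (nat \<Rightarrow> 'a \<Rightarrow> real) \<Rightarrow> source \<Rightarrow> 'a set set" where
  "source_events \<Omega> A M S N Message = {M -` B \<inter> space \<Omega> | B. B \<in> sets (message_space A)}"
| "source_events \<Omega> A M S N (Secret i j) = {S i j -` B \<inter> space \<Omega> | B. B \<in> sets (count_space {0, 1})}"
| "source_events \<Omega> A M S N (Noise j) = {N j -` B \<inter> space \<Omega> | B. B \<in> sets borel}"

locale willie_channel = prob_space \<Omega>
  for \<Omega> :: "'a measure" +
  fixes n :: nat
    and A :: "nat set"
    and v\<^sub>W :: real
    and M :: "'a \<Rightarrow> nat \<Rightarrow> nat"
    and S :: "nat \<Rightarrow> nat \<Rightarrow> 'a \<Rightarrow> nat"
    and N :: "nat \<Rightarrow> 'a \<Rightarrow> real"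
  assumes M_random: "random_variable (message_space A) M"
    and S_random: "\<And>i j. i \<in> A \<Longrightarrow> j \<in> {1..n} \<Longrightarrow> random_variable (count_space {0, 1}) (S i j)"
    and S_uniform: "\<And>i j. i \<in> A \<Longrightarrow> j \<in> {1..n} \<Longrightarrow>
          distr \<Omega> (count_space {0, 1}) (S i j) = uniform_count_measure {0, 1}"
    and N_gaussian: "\<And>j. j \<in> {1..n} \<Longrightarrow>
          distributed \<Omega> lborel (N j) (\<lambda>x. ennreal (normal_density 0 (sqrt v\<^sub>W) x))"
    and independent: "indep_sets (source_events \<Omega> A M S N)
          ({Message} \<union> {Secret i j | i j. i \<in> A \<and> j \<in> {1..n}} \<union> {Noise j | j. j \<in> {1..n}})"

end

theory Submission
  imports Defs
begin

text \<open>
  Since every secret is a fair coin, the transmitted bits are uniform and independent of \<open>M\<close>, so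
  \<open>P\<^bsub>Z,M\<^esub>\<close> is the product of \<open>P\<^sub>M\<close> and the \<open>n\<close>-th power of a mixture \<open>p\<close> of the Gaussians with variance
  \<open>v\<^sub>W\<close> centred at \<open>c = \<Sum>\<^sub>i \<plusminus>\<beta>\<^sub>i\<close>, where \<open>\<beta>\<^sub>i = b\<^sub>i / sqrt n\<close>. It is compared with the power of the Gaussian
  density \<open>q\<close> that has the same variance \<open>v = v\<^sub>W + p\<^sub>2\<close>, where \<open>p\<^sub>2 = \<Sum>\<^sub>i \<beta>\<^sub>i\<^sup>2\<close>; this \<open>v\<close> tends to \<open>v\<^sub>W\<close> and
  hence eventually lies in the open set \<open>V\<close>. By Cauchy-Schwarz and multiplicativity of the second
  moment of the likelihood ratio, the distance is at most \<open>1/2 sqrt ((1 + \<chi>)\<^sup>n - 1)\<close> with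
  \<open>\<chi> = \<integral> (p - q)\<^sup>2 / q\<close>, so it suffices that \<open>n \<chi> \<longrightarrow> 0\<close>.

  Replacing \<open>q\<close> in the denominator by the density \<open>r\<close> with variance \<open>v\<^sub>W\<close> costs a bounded factor and makes
  all integrals explicit; after cancellation \<open>\<chi>\<close> is controlled by the difference between the product
  of \<open>exp (x\<^sub>i\<^sup>2 / 2)\<close> and that of \<open>cosh x\<^sub>i\<close>, with \<open>x\<^sub>i\<close> of order \<open>sqrt p\<^sub>2 \<beta>\<^sub>i\<close>. As the two factors agree to
  third order, \<open>\<chi> = O (p\<^sub>2\<^sup>2 (\<Sum>\<^sub>i \<beta>\<^sub>i\<^sup>4))\<close> and \<open>n \<chi> = O ((l / n)\<^sup>3)\<close>.
\<close>

section \<open>Variational distance of product measures\<close>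

text \<open>A real supremum is informative only for a non-empty set that is bounded above. The total
  masses of \<open>P\<close> and \<open>Q\<close> bound every partition sum, and a single
  non-negative sum then suffices.\<close>

lemma tv_norm_diff_nonneg:
  assumes "finite_measure P" "finite_measure Q" and sets: "sets P = sets Q"
  shows "0 \<le> tv_norm_diff P Q"
proof -
  interpret P: finite_measure P by fact
  interpret Q: finite_measure Q by fact
  let ?F = "{\<pi>. finite \<pi> \<and> \<pi> \<subseteq> sets P \<and> partition_on (space P) \<pi>}"
  have bound: "(\<Sum>B\<in>\<pi>. \<bar>measure P B - measure Q B\<bar>) \<le> measure P (space P) + measure Q (space P)"
    if \<pi>: "\<pi> \<in> ?F" for \<pi>
  proof -
    have "(\<Sum>B\<in>\<pi>. \<bar>measure P B - measure Q B\<bar>) \<le> (\<Sum>B\<in>\<pi>. measure P B + measure Q B)"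
      by (intro sum_mono) (smt (verit) measure_nonneg)
    also have "\<dots> = measure P (\<Union>\<pi>) + measure Q (\<Union>\<pi>)"
      using \<pi> P.finite_measure_finite_Union[of \<pi> id] Q.finite_measure_finite_Union[of \<pi> id]
      by (auto simp: sum.distrib sets disjoint_family_on_def pairwise_def disjnt_def partition_on_def)
    finally show ?thesis using \<pi> by (auto simp: partition_on_def)
  qed
  have "bdd_above ((\<lambda>\<pi>. \<Sum>B\<in>\<pi>. \<bar>measure P B - measure Q B\<bar>) ` ?F)"
    using bound by (intro bdd_aboveI2)
  \<comment> \<open>\<open>partition_on\<close> forbids empty cells; removing \<open>{}\<close>
    turns the one-cell partition into the empty one when the space is empty.\<close>
  moreover have "{space P} - {{}} \<in> ?F"
    by (auto simp: partition_on_def pairwise_def)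
  ultimately show ?thesis
    unfolding tv_norm_diff_def by (rule cSUP_upper2) (auto intro!: sum_nonneg)
qed

text \<open>On each cell the measures differ by the integral of \<open>L - 1\<close>, which the
  triangle inequality bounds; the bounds add up over the disjoint cells.\<close>

lemma tv_norm_diff_density_le:
  assumes "finite_measure Q"
    and L: "integrable Q L" "\<And>x. 0 \<le> L x"
  shows "tv_norm_diff (density Q (\<lambda>x. ennreal (L x))) Q \<le> (\<integral>x. \<bar>L x - 1\<bar> \<partial>Q)"
proof -
  interpret Q: finite_measure Q by fact
  let ?P = "density Q (\<lambda>x. ennreal (L x))"
  have [measurable]: "L \<in> borel_measurable Q"
    using L(1) by auto
  have diff: "integrable Q (\<lambda>x. L x - 1)"
    using L(1) by simp
  have pt: "\<bar>measure ?P B - measure Q B\<bar> \<le> (\<integral>x\<in>B. \<bar>L x - 1\<bar> \<partial>Q)" if B[measurable]: "B \<in> sets Q" for B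
  proof -
    have P: "measure ?P B = (\<integral>x\<in>B. L x \<partial>Q)"
      using L by (simp add: set_lebesgue_integral_def measure_def emeasure_density
          integral_eq_nn_integral ennreal_mult' mult.commute flip: ennreal_indicator)
    have "set_integrable Q B L" "set_integrable Q B (\<lambda>_. 1 :: real)"
      unfolding set_integrable_def by (intro integrable_mult_indicator; use L B in simp)+
    then have "measure ?P B - measure Q B = (\<integral>x\<in>B. L x - 1 \<partial>Q)"
      unfolding P by (subst set_integral_diff) (auto simp: set_lebesgue_integral_def)
    also have "\<bar>\<dots>\<bar> \<le> (\<integral>x\<in>B. \<bar>L x - 1\<bar> \<partial>Q)"
      using set_integral_norm_bound[of Q B "\<lambda>x. L x - 1"] integrable_mult_indicator[OF B diff]
      by (simp add: set_integrable_def)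
    finally show ?thesis .
  qed
  show ?thesis
    unfolding tv_norm_diff_def
  proof (rule cSUP_least)
    show "{\<pi>. finite \<pi> \<and> \<pi> \<subseteq> sets ?P \<and> partition_on (space ?P) \<pi>} \<noteq> {}"
      by (auto simp: partition_on_def pairwise_def intro!: exI[of _ "{space Q} - {{}}"])
    fix \<pi> assume "\<pi> \<in> {\<pi>. finite \<pi> \<and> \<pi> \<subseteq> sets ?P \<and> partition_on (space ?P) \<pi>}"
    then have \<pi>: "finite \<pi>" "\<And>B. B \<in> \<pi> \<Longrightarrow> B \<in> sets Q" "\<Union>\<pi> = space Q" "disjoint \<pi>"
      by (auto simp: partition_on_def)
    have "(\<Sum>B\<in>\<pi>. \<bar>measure ?P B - measure Q B\<bar>) \<le> (\<Sum>B\<in>\<pi>. \<integral>x\<in>B. \<bar>L x - 1\<bar> \<partial>Q)"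
      using \<pi> by (intro sum_mono pt) auto
    also have "\<dots> = (\<integral>x\<in>(\<Union>B\<in>\<pi>. B). \<bar>L x - 1\<bar> \<partial>Q)"
      using \<pi> integrable_mult_indicator[OF _ integrable_abs[OF diff]]
      by (intro set_integral_finite_Union[symmetric])
        (auto simp: set_integrable_def disjoint_family_on_def pairwise_def disjnt_def)
    also have "\<dots> = (\<integral>x. \<bar>L x - 1\<bar> \<partial>Q)"
      using \<pi> diff by (simp add: set_integral_space)
    finally show "(\<Sum>B\<in>\<pi>. \<bar>measure ?P B - measure Q B\<bar>) \<le> (\<integral>x. \<bar>L x - 1\<bar> \<partial>Q)" .
  qed
qed

text \<open>This is non-negativity of the variance of \<open>\<bar>X\<bar>\<close>.\<close>

lemma (in prob_space) expectation_abs_le_sqrt: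
  fixes X :: "'a \<Rightarrow> real"
  assumes [measurable]: "random_variable borel X" and "integrable M (\<lambda>x. (X x)\<^sup>2)"
  shows "expectation (\<lambda>x. \<bar>X x\<bar>) \<le> sqrt (expectation (\<lambda>x. (X x)\<^sup>2))"
proof -
  have X: "integrable M X"
    using assms by (rule square_integrable_imp_integrable)
  have "0 \<le> variance (\<lambda>x. \<bar>X x\<bar>)"
    by (rule variance_positive)
  also have "\<dots> = expectation (\<lambda>x. (X x)\<^sup>2) - (expectation (\<lambda>x. \<bar>X x\<bar>))\<^sup>2"
    using X assms by (subst variance_eq) auto
  finally show ?thesis
    by (intro real_le_rsqrt) simp
qed

text \<open>Since \<open>L\<close> has mean one, expanding \<open>(L - 1)\<^sup>2\<close> leaves the
  second moment minus one. Unlike the absolute deviation, the second moment multiplies over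
  independent coordinates.\<close>

lemma (in prob_space) expectation_abs_minus_one_le:
  fixes L :: "'a \<Rightarrow> real"
  assumes [measurable]: "random_variable borel L" and sq: "integrable M (\<lambda>x. (L x)\<^sup>2)"
    and one: "expectation L = 1"
  shows "expectation (\<lambda>x. \<bar>L x - 1\<bar>) \<le> sqrt (expectation (\<lambda>x. (L x)\<^sup>2) - 1)"
proof -
  have L: "integrable M L"
    using assms(1) sq by (rule square_integrable_imp_integrable)
  have eq: "(\<lambda>x. (L x - 1)\<^sup>2) = (\<lambda>x. (L x)\<^sup>2 - 2 * L x + 1)"
    by (simp add: fun_eq_iff power2_eq_square algebra_simps)
  have "expectation (\<lambda>x. \<bar>L x - 1\<bar>) \<le> sqrt (expectation (\<lambda>x. (L x - 1)\<^sup>2))"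
    using L sq by (intro expectation_abs_le_sqrt) (auto simp: eq)
  also have "expectation (\<lambda>x. (L x - 1)\<^sup>2) = expectation (\<lambda>x. (L x)\<^sup>2) - 1"
    unfolding eq using L sq one by (simp add: prob_space)
  finally show ?thesis .
qed

text \<open>Finite products are determined by their values on boxes, where both the product density
  and the indicator factor into coordinates. Hypothesis \<open>P\<close> makes the factors on the
  left sigma-finite, as uniqueness requires.\<close>

lemma PiM_density:
  fixes L :: "'b \<Rightarrow> real"
  assumes "prob_space Q" "finite I"
    and [measurable]: "L \<in> borel_measurable Q" and L: "\<And>x. 0 \<le> L x"
    and P: "prob_space (density Q (\<lambda>x. ennreal (L x)))"
  shows "(\<Pi>\<^sub>M i\<in>I. density Q (\<lambda>x. ennreal (L x)))
    = density (\<Pi>\<^sub>M i\<in>I. Q) (\<lambda>x. ennreal (\<Prod>i\<in>I. L (x i)))"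
proof -
  interpret Q: prob_space Q by fact
  interpret P: prob_space "density Q (\<lambda>x. ennreal (L x))" by fact
  interpret Q: product_sigma_finite "\<lambda>i. Q" by standard
  interpret P: product_sigma_finite "\<lambda>i. density Q (\<lambda>x. ennreal (L x))" by standard
  show ?thesis
  proof (rule P.PiM_eqI[symmetric, OF \<open>finite I\<close>])
    show "sets (density (\<Pi>\<^sub>M i\<in>I. Q) (\<lambda>x. ennreal (\<Prod>i\<in>I. L (x i))))
        = sets (\<Pi>\<^sub>M i\<in>I. density Q (\<lambda>x. ennreal (L x)))"
      by (auto intro!: sets_PiM_cong)
    fix A assume "\<And>i. i \<in> I \<Longrightarrow> A i \<in> sets (density Q (\<lambda>x. ennreal (L x)))"
    then have A[measurable]: "\<And>i. i \<in> I \<Longrightarrow> A i \<in> sets Q" by simp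
    have "emeasure (density (\<Pi>\<^sub>M i\<in>I. Q) (\<lambda>x. ennreal (\<Prod>i\<in>I. L (x i)))) (Pi\<^sub>E I A)
        = (\<integral>\<^sup>+x. ennreal (\<Prod>i\<in>I. L (x i)) * indicator (Pi\<^sub>E I A) x \<partial>(\<Pi>\<^sub>M i\<in>I. Q))"
      using A \<open>finite I\<close> by (intro emeasure_density) auto
    also have "\<dots> = (\<integral>\<^sup>+x. (\<Prod>i\<in>I. ennreal (L (x i)) * indicator (A i) (x i)) \<partial>(\<Pi>\<^sub>M i\<in>I. Q))"
    proof (intro nn_integral_cong)
      fix x assume "x \<in> space (\<Pi>\<^sub>M i\<in>I. Q)"
      \<comment> \<open>Membership in \<open>Pi\<^sub>E I A\<close> includes extensionality, so its
        indicator factors over coordinates only on the space of the product measure.\<close>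
      then have "x \<in> extensional I" by (simp add: space_PiM PiE_def)
      then have "indicator (Pi\<^sub>E I A) x = (\<Prod>i\<in>I. indicator (A i) (x i) :: ennreal)"
        using \<open>finite I\<close> by (auto simp: indicator_def PiE_def Pi_iff intro!: prod.neutral)
      then show "ennreal (\<Prod>i\<in>I. L (x i)) * indicator (Pi\<^sub>E I A) x
          = (\<Prod>i\<in>I. ennreal (L (x i)) * indicator (A i) (x i))"
        using L by (simp add: prod.distrib prod_ennreal)
    qed
    also have "\<dots> = (\<Prod>i\<in>I. \<integral>\<^sup>+x. ennreal (L x) * indicator (A i) x \<partial>Q)"
      using \<open>finite I\<close> by (intro Q.product_nn_integral_prod) auto
    also have "\<dots> = (\<Prod>i\<in>I. emeasure (density Q (\<lambda>x. ennreal (L x))) (A i))"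
      by (intro prod.cong) (auto simp: emeasure_density)
    finally show "emeasure (density (\<Pi>\<^sub>M i\<in>I. Q) (\<lambda>x. ennreal (\<Prod>i\<in>I. L (x i)))) (Pi\<^sub>E I A)
        = (\<Prod>i\<in>I. emeasure (density Q (\<lambda>x. ennreal (L x))) (A i))" .
  qed
qed

text \<open>The common factor \<open>R\<close> leaves a likelihood ratio that depends on the first
  component alone. For the product ratio, \<open>expectation_abs_minus_one_le\<close> applies, and
  its second moment is a power of the second moment in one coordinate.\<close>

lemma variational_distance_power_le:
  fixes L :: "'b \<Rightarrow> real"
  assumes Q: "prob_space Q" and R: "prob_space R" and "finite I"
    and [measurable]: "L \<in> borel_measurable Q" and L: "\<And>x. 0 \<le> L x"
    and sq: "integrable Q (\<lambda>x. (L x)\<^sup>2)" and one: "(\<integral>x. L x \<partial>Q) = 1"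
  shows "variational_distance ((\<Pi>\<^sub>M i\<in>I. density Q (\<lambda>x. ennreal (L x))) \<Otimes>\<^sub>M R) ((\<Pi>\<^sub>M i\<in>I. Q) \<Otimes>\<^sub>M R)
    \<le> 1 / 2 * sqrt ((\<integral>x. (L x)\<^sup>2 \<partial>Q) ^ card I - 1)"
proof -
  interpret Q: prob_space Q by fact
  interpret R: prob_space R by fact
  interpret Qn: product_prob_space "\<lambda>i. Q" I by standard
  interpret QR: pair_prob_space "\<Pi>\<^sub>M i\<in>I. Q" R by standard
  have int: "integrable Q L"
    using assms(4) sq by (rule Q.square_integrable_imp_integrable)
  have P: "prob_space (density Q (\<lambda>x. ennreal (L x)))"
    using L int one by (intro prob_spaceI) (simp add: emeasure_density nn_integral_eq_integral)
  let ?\<Lambda> = "\<lambda>x. \<Prod>i\<in>I. L (x i)"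
  have \<Lambda>: "integrable (\<Pi>\<^sub>M i\<in>I. Q) ?\<Lambda>" "(\<integral>x. ?\<Lambda> x \<partial>(\<Pi>\<^sub>M i\<in>I. Q)) = 1"
    using Qn.product_integrable_prod[of I "\<lambda>_. L"] Qn.product_integral_prod[of I "\<lambda>_. L"]
      \<open>finite I\<close> int one by simp_all
  have \<Lambda>2: "integrable (\<Pi>\<^sub>M i\<in>I. Q) (\<lambda>x. (?\<Lambda> x)\<^sup>2)"
      "(\<integral>x. (?\<Lambda> x)\<^sup>2 \<partial>(\<Pi>\<^sub>M i\<in>I. Q)) = (\<integral>x. (L x)\<^sup>2 \<partial>Q) ^ card I"
    using Qn.product_integrable_prod[of I "\<lambda>_ x. (L x)\<^sup>2"]
      Qn.product_integral_prod[of I "\<lambda>_ x. (L x)\<^sup>2"] \<open>finite I\<close> sq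
    by (simp_all add: prod_power_distrib)
  have "(\<Pi>\<^sub>M i\<in>I. density Q (\<lambda>x. ennreal (L x))) \<Otimes>\<^sub>M R
      = density (\<Pi>\<^sub>M i\<in>I. Q) (\<lambda>x. ennreal (?\<Lambda> x)) \<Otimes>\<^sub>M density R (\<lambda>_. 1)"
    using PiM_density[OF Q \<open>finite I\<close> _ L P] by (simp add: density_1)
  also have "\<dots> = density ((\<Pi>\<^sub>M i\<in>I. Q) \<Otimes>\<^sub>M R) (\<lambda>x. ennreal (?\<Lambda> (fst x)))"
    by (subst pair_measure_density) (auto simp: density_1 R.sigma_finite_measure_axioms intro!: arg_cong[where f = "density _"])
  finally have eq: "(\<Pi>\<^sub>M i\<in>I. density Q (\<lambda>x. ennreal (L x))) \<Otimes>\<^sub>M R = \<dots>" .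
  have fst: "(\<integral>x. f (fst x) \<partial>((\<Pi>\<^sub>M i\<in>I. Q) \<Otimes>\<^sub>M R)) = (\<integral>x. f x \<partial>(\<Pi>\<^sub>M i\<in>I. Q))"
    if "f \<in> borel_measurable (\<Pi>\<^sub>M i\<in>I. Q)" for f :: "_ \<Rightarrow> real"
    using integral_distr[of fst "(\<Pi>\<^sub>M i\<in>I. Q) \<Otimes>\<^sub>M R" "\<Pi>\<^sub>M i\<in>I. Q" f] that
    by (simp add: R.distr_pair_fst)
  have "integrable ((\<Pi>\<^sub>M i\<in>I. Q) \<Otimes>\<^sub>M R) (\<lambda>x. ?\<Lambda> (fst x))"
    using integrable_distr_eq[of fst "(\<Pi>\<^sub>M i\<in>I. Q) \<Otimes>\<^sub>M R" "\<Pi>\<^sub>M i\<in>I. Q" ?\<Lambda>] \<Lambda>(1)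
    by (simp add: R.distr_pair_fst)
  then have "tv_norm_diff (density ((\<Pi>\<^sub>M i\<in>I. Q) \<Otimes>\<^sub>M R) (\<lambda>x. ennreal (?\<Lambda> (fst x)))) ((\<Pi>\<^sub>M i\<in>I. Q) \<Otimes>\<^sub>M R)
      \<le> (\<integral>x. \<bar>?\<Lambda> (fst x) - 1\<bar> \<partial>((\<Pi>\<^sub>M i\<in>I. Q) \<Otimes>\<^sub>M R))"
    by (intro tv_norm_diff_density_le QR.finite_measure_axioms) (auto intro: prod_nonneg L)
  also have "\<dots> = (\<integral>x. \<bar>?\<Lambda> x - 1\<bar> \<partial>(\<Pi>\<^sub>M i\<in>I. Q))"
    by (intro fst) measurable
  also have "\<dots> \<le> sqrt ((\<integral>x. (L x)\<^sup>2 \<partial>Q) ^ card I - 1)"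
    using Qn.expectation_abs_minus_one_le[of ?\<Lambda>] \<Lambda> \<Lambda>2 by simp
  finally show ?thesis
    unfolding variational_distance_def eq by simp
qed

section \<open>Hyperbolic cosines and Gaussian integrals\<close>

text \<open>The power series are compared term by term: the coefficient of
  \<open>x ^ (2 * n)\<close> is \<open>1 / fact (2 * n)\<close> on the left and
  \<open>1 / (2 ^ n * fact n)\<close> on the right.\<close>

lemma cosh_le_exp_half_square: "cosh x \<le> exp (x\<^sup>2 / 2)" for x :: real
proof -
  have fact: "2 ^ n * fact n \<le> (fact (2 * n) :: real)" for n :: nat
  proof (induction n)
    case (Suc n)
    have "2 ^ Suc n * fact (Suc n) = 2 * real (Suc n) * (2 ^ n * fact n)"
      by (simp add: algebra_simps)
    also have "\<dots> \<le> 2 * real (Suc n) * fact (2 * n)"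
      using Suc by (intro mult_left_mono) auto
    also have "\<dots> \<le> real (2 * n + 2) * (real (2 * n + 1) * fact (2 * n))"
      by (simp add: algebra_simps)
    also have "\<dots> = fact (2 * Suc n)"
      by (simp add: algebra_simps)
    finally show ?case .
  qed simp
  have "(\<lambda>n. if even n then x ^ n /\<^sub>R fact n else 0) sums cosh x"
    by (rule cosh_converges)
  \<comment> \<open>Grouping consecutive pairs absorbs the vanishing odd terms.\<close>
  then have "(\<lambda>n. \<Sum>k = n * 2..<n * 2 + 2. if even k then x ^ k /\<^sub>R fact k else 0) sums cosh x"
    by (rule sums_group) simp
  moreover have "(\<Sum>k = n * 2..<n * 2 + 2. if even k then x ^ k /\<^sub>R fact k else 0)
      = x ^ (2 * n) / fact (2 * n)" for n
  proof -
    have "{n * 2..<n * 2 + 2} = {2 * n, Suc (2 * n)}"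
      by auto
    then show ?thesis
      by (simp add: divide_inverse_commute)
  qed
  ultimately have cosh: "(\<lambda>n. x ^ (2 * n) / fact (2 * n)) sums cosh x"
    by simp
  have exp: "(\<lambda>n. u ^ n / fact n) sums exp u" for u :: real
    using exp_converges[of u] by (simp add: divide_inverse_commute)
  have "x ^ (2 * n) / fact (2 * n) \<le> (x\<^sup>2 / 2) ^ n / fact n" for n
  proof -
    have "x ^ (2 * n) / fact (2 * n) \<le> x ^ (2 * n) / (2 ^ n * fact n)"
      using fact[of n] by (intro divide_left_mono) auto
    then show ?thesis
      by (simp add: power_mult power_divide)
  qed
  then show ?thesis
    by (rule sums_le[OF _ cosh exp])
qed

text \<open>Both functions start with \<open>1 + x\<^sup>2 / 2\<close> and have no cubic term. The
  error is stated relative to \<open>exp (x\<^sup>2 / 2)\<close>, the form in which errors add up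
  over a product.\<close>

lemma exp_half_square_minus_cosh_le: "exp (x\<^sup>2 / 2) - cosh x \<le> x ^ 4 / 8 * exp (x\<^sup>2 / 2)" for x :: real
proof -
  \<comment> \<open>The fourth-order remainder is non-negative for either sign of \<open>y\<close>;
    adding the bounds at \<open>x\<close> and \<open>-x\<close> cancels the odd terms.\<close>
  have "1 + y + y\<^sup>2 / 2 + y ^ 3 / 6 \<le> exp y" for y :: real
  proof -
    obtain \<xi> where "exp y = (\<Sum>m<4. y ^ m / fact m) + exp \<xi> / fact 4 * y ^ 4"
      using Maclaurin_exp_le by blast
    moreover have "0 \<le> exp \<xi> / fact 4 * y ^ 4"
      by (intro mult_nonneg_nonneg) auto
    ultimately show ?thesis
      by (simp add: numeral_eq_Suc)
  qed
  from this[of x] this[of "-x"] have "1 + x\<^sup>2 / 2 \<le> cosh x"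
    by (simp add: cosh_def)
  moreover have "exp u \<le> 1 + u + u\<^sup>2 / 2 * exp u" if "0 \<le> u" for u :: real
  proof -
    obtain \<xi> where \<xi>: "\<bar>\<xi>\<bar> \<le> \<bar>u\<bar>" "exp u = (\<Sum>m<2. u ^ m / fact m) + exp \<xi> / fact 2 * u ^ 2"
      using Maclaurin_exp_le by blast
    from \<xi>(1) have "exp \<xi> / 2 * u\<^sup>2 \<le> exp u / 2 * u\<^sup>2"
      using that by (intro mult_right_mono divide_right_mono) auto
    moreover have "exp u = 1 + u + exp \<xi> / 2 * u\<^sup>2"
      using \<xi>(2) by (simp add: eval_nat_numeral)
    ultimately show ?thesis
      by (simp add: mult.commute)
  qed
  from this[of "x\<^sup>2 / 2"] have "exp (x\<^sup>2 / 2) \<le> 1 + x\<^sup>2 / 2 + (x\<^sup>2 / 2)\<^sup>2 / 2 * exp (x\<^sup>2 / 2)"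
    by simp
  moreover have "(x\<^sup>2 / 2)\<^sup>2 / 2 = x ^ 4 / 8"
    by (simp add: power2_eq_square power4_eq_xxxx)
  ultimately show ?thesis by simp
qed

text \<open>Factors are exchanged one at a time. The relative errors \<open>e i\<close> add up,
  because \<open>g i \<le> f i\<close> lets each remaining factor of \<open>g\<close> be replaced by
  one of \<open>f\<close>.\<close>

lemma prod_diff_le:
  fixes f g :: "'b \<Rightarrow> real"
  assumes "finite I" "\<And>i. i \<in> I \<Longrightarrow> 0 \<le> g i" "\<And>i. i \<in> I \<Longrightarrow> g i \<le> f i"
    and "\<And>i. i \<in> I \<Longrightarrow> f i - g i \<le> e i * f i"
  shows "prod f I - prod g I \<le> sum e I * prod f I"
  using assms
proof (induction I rule: finite_induct)
  case (insert i I)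
  have g_le: "0 \<le> g j" "g j \<le> f j" "0 \<le> f j" if "j \<in> insert i I" for j
    using insert.prems(1)[OF that] insert.prems(2)[OF that] by linarith+
  then have f: "0 \<le> prod f I" "0 \<le> prod g I" "prod g I \<le> prod f I"
    by (simp_all add: prod_nonneg prod_mono)
  have "prod f (insert i I) - prod g (insert i I)
      = (f i - g i) * prod f I + g i * (prod f I - prod g I)"
    using insert.hyps by (simp add: algebra_simps)
  also have "\<dots> \<le> (e i * f i) * prod f I + f i * (prod f I - prod g I)"
    using insert.prems(3) g_le f by (intro add_mono mult_right_mono) simp_all
  also have "\<dots> \<le> (e i * f i) * prod f I + f i * (sum e I * prod f I)"
    using insert.prems insert.IH g_le by (intro add_mono mult_left_mono order_refl) simp_all
  also have "\<dots> = sum e (insert i I) * prod f (insert i I)"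
    using insert.hyps by (simp add: algebra_simps)
  finally show ?case .
qed simp

lemma prod_exp_minus_prod_cosh_le:
  fixes x :: "'b \<Rightarrow> real"
  assumes "finite I"
  shows "exp ((\<Sum>i\<in>I. (x i)\<^sup>2) / 2) - (\<Prod>i\<in>I. cosh (x i))
    \<le> (\<Sum>i\<in>I. x i ^ 4) / 8 * exp ((\<Sum>i\<in>I. (x i)\<^sup>2) / 2)"
  using prod_diff_le[OF assms, of "\<lambda>i. cosh (x i)" "\<lambda>i. exp ((x i)\<^sup>2 / 2)" "\<lambda>i. x i ^ 4 / 8"]
    cosh_le_exp_half_square exp_half_square_minus_cosh_le
  by (simp add: exp_sum[OF assms] sum_divide_distrib cosh_real_nonneg)

text \<open>
  A word \<open>s\<close> gives the bits that the active senders transmit in one channel use; \<open>level A \<beta> s\<close> is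
  the resulting noiseless signal, and \<open>mean A f\<close> averages over uniformly distributed words.
\<close>

definition level :: "'b set \<Rightarrow> ('b \<Rightarrow> real) \<Rightarrow> ('b \<Rightarrow> nat) \<Rightarrow> real" where
  "level A \<beta> s = (\<Sum>i\<in>A. \<beta> i * (-1) ^ s i)"

definition words :: "'b set \<Rightarrow> ('b \<Rightarrow> nat) set" where
  "words A = (\<Pi>\<^sub>E i\<in>A. {0, 1})"

definition mean :: "'b set \<Rightarrow> (('b \<Rightarrow> nat) \<Rightarrow> real) \<Rightarrow> real" where
  "mean A f = (\<Sum>s\<in>words A. f s) / 2 ^ card A"

lemma finite_words: "finite A \<Longrightarrow> finite (words A)"
  by (simp add: words_def finite_PiE)

text \<open>Under the uniform distribution on words the bits are independent and fair, so
  expectations of products factor.\<close>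

lemma mean_prod:
  assumes "finite A"
  shows "mean A (\<lambda>s. \<Prod>i\<in>A. f i (s i)) = (\<Prod>i\<in>A. (f i 0 + f i 1) / 2)"
  using prod_sum_PiE[OF assms, of "\<lambda>_. {0, 1}" f]
  by (simp add: mean_def words_def prod_dividef)

lemma mean_const: "finite A \<Longrightarrow> mean A (\<lambda>_. c) = c"
  by (simp add: mean_def words_def card_PiE numeral_2_eq_2[symmetric])

lemma mean_exp_level:
  assumes "finite A"
  shows "mean A (\<lambda>s. exp (a * level A \<beta> s)) = (\<Prod>i\<in>A. cosh (a * \<beta> i))"
  using mean_prod[OF assms, of "\<lambda>i e. exp (a * (\<beta> i * (-1) ^ e))"]
  by (simp add: level_def sum_distrib_left exp_sum[OF assms] cosh_def)

lemma mean_mono: "(\<And>s. s \<in> words A \<Longrightarrow> f s \<le> g s) \<Longrightarrow> mean A f \<le> mean A g"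
  unfolding mean_def by (intro divide_right_mono sum_mono) auto

text \<open>The signal of random bits is sub-Gaussian: the bound on cosh for each sender gives the
  exponential moment of a centred Gaussian with the same variance.\<close>

lemma mean_exp_level_le:
  assumes "finite A"
  shows "mean A (\<lambda>s. exp (a * level A \<beta> s)) \<le> exp (a\<^sup>2 * (\<Sum>i\<in>A. (\<beta> i)\<^sup>2) / 2)"
proof -
  have "(\<Prod>i\<in>A. cosh (a * \<beta> i)) \<le> (\<Prod>i\<in>A. exp ((a * \<beta> i)\<^sup>2 / 2))"
    using cosh_le_exp_half_square by (intro prod_mono) (auto simp: cosh_real_nonneg)
  also have "\<dots> = exp (a\<^sup>2 * (\<Sum>i\<in>A. (\<beta> i)\<^sup>2) / 2)"
    by (simp add: exp_sum[OF assms, symmetric] sum_distrib_left sum_divide_distrib power_mult_distrib)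
  finally show ?thesis
    by (simp add: mean_exp_level[OF assms])
qed

section \<open>Integrals of averages and of Gaussian densities\<close>

lemma has_integral_le:
  fixes f g :: "'c \<Rightarrow> real"
  assumes "has_bochner_integral M f a" "has_bochner_integral M g b" "\<And>x. f x \<le> g x"
  shows "a \<le> b"
  using assms integral_mono[of M f g] by (auto simp: has_bochner_integral_iff)

lemma has_integral_mean:
  assumes "finite A" and "\<And>s. s \<in> words A \<Longrightarrow> has_bochner_integral lborel (f s) (c s)"
  shows "has_bochner_integral lborel (\<lambda>x. mean A (\<lambda>s. f s x)) (mean A c)"
proof -
  have "has_bochner_integral lborel (\<lambda>x. \<Sum>s\<in>words A. f s x) (sum c (words A))"
    using assms by (intro has_bochner_integral_sum)
  from has_bochner_integral_mult_left[OF this, of "1 / 2 ^ card A"] show ?thesis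
    by (simp add: mean_def)
qed

lemma has_integral_normal_density:
  "0 < \<sigma> \<Longrightarrow> has_bochner_integral lborel (\<lambda>x. C * normal_density \<mu> \<sigma> x) C"
proof -
  assume "0 < \<sigma>"
  then have "has_bochner_integral lborel (normal_density \<mu> \<sigma>) 1"
    by (simp add: has_bochner_integral_iff)
  from has_bochner_integral_mult_right[OF this, of C] show ?thesis
    by simp
qed

lemma normal_density_sqrt:
  "0 < v \<Longrightarrow> normal_density \<mu> (sqrt v) x = exp (- (x - \<mu>)\<^sup>2 / (2 * v)) / sqrt (2 * pi * v)"
  by (simp add: normal_density_def)

text \<open>Completing the square. This serves the square of the mixture in the chi-square
  integral.\<close>

lemma normal_density_mult_div:
  assumes "0 < v"
  shows "normal_density a (sqrt v) x * normal_density c (sqrt v) x / normal_density 0 (sqrt v) x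
    = exp (a * c / v) * normal_density (a + c) (sqrt v) x"
proof -
  have "- (x - a)\<^sup>2 / (2 * v) + - (x - c)\<^sup>2 / (2 * v) - (- (x - 0)\<^sup>2 / (2 * v))
      = a * c / v + - (x - (a + c))\<^sup>2 / (2 * v)"
    using assms by (simp add: field_simps power2_eq_square)
  then have "exp (- (x - a)\<^sup>2 / (2 * v)) * exp (- (x - c)\<^sup>2 / (2 * v)) / exp (- (x - 0)\<^sup>2 / (2 * v))
      = exp (a * c / v) * exp (- (x - (a + c))\<^sup>2 / (2 * v))"
    by (simp only: exp_add[symmetric] exp_diff[symmetric])
  then show ?thesis
    using assms by (simp add: normal_density_sqrt divide_simps)
qed

text \<open>Completing the square for the cross term of a mixture component with the Gaussian of
  variance \<open>w\<close>; the centre is rescaled by \<open>w / v\<close>.\<close>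

lemma normal_density_mult_div':
  assumes "0 < v" "0 < w"
  shows "normal_density c (sqrt v) x * normal_density 0 (sqrt w) x / normal_density 0 (sqrt v) x
    = exp (c\<^sup>2 * (w - v) / (2 * v\<^sup>2)) * normal_density (c * w / v) (sqrt w) x"
proof -
  have "- (x - c)\<^sup>2 / (2 * v) + - (x - 0)\<^sup>2 / (2 * w) - (- (x - 0)\<^sup>2 / (2 * v))
      = c\<^sup>2 * (w - v) / (2 * v\<^sup>2) + - (x - c * w / v)\<^sup>2 / (2 * w)"
    using assms by (simp add: field_simps power2_eq_square)
  then have "exp (- (x - c)\<^sup>2 / (2 * v)) * exp (- (x - 0)\<^sup>2 / (2 * w)) / exp (- (x - 0)\<^sup>2 / (2 * v))
      = exp (c\<^sup>2 * (w - v) / (2 * v\<^sup>2)) * exp (- (x - c * w / v)\<^sup>2 / (2 * w))"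
    by (simp only: exp_add[symmetric] exp_diff[symmetric])
  then show ?thesis
    using assms by (simp add: normal_density_sqrt divide_simps)
qed

text \<open>The reciprocal of the resulting variance is \<open>2 / w - 1 / v\<close>, which is
  positive because \<open>w < 2 * v\<close>.\<close>

lemma normal_density_square_div:
  assumes "0 < v" "0 < w" "w < 2 * v"
  shows "(normal_density 0 (sqrt w) x)\<^sup>2 / normal_density 0 (sqrt v) x
    = v / sqrt (w * (2 * v - w)) * normal_density 0 (sqrt (v * w / (2 * v - w))) x"
proof -
  let ?u = "v * w / (2 * v - w)"
  have u: "0 < ?u" using assms by simp
  have "- (x - 0)\<^sup>2 / (2 * w) + - (x - 0)\<^sup>2 / (2 * w) - (- (x - 0)\<^sup>2 / (2 * v))
      = - (x - 0)\<^sup>2 / (2 * ?u)"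
    using assms by (simp add: field_simps power2_eq_square)
  then have e: "exp (- (x - 0)\<^sup>2 / (2 * w)) * exp (- (x - 0)\<^sup>2 / (2 * w)) / exp (- (x - 0)\<^sup>2 / (2 * v))
      = exp (- (x - 0)\<^sup>2 / (2 * ?u))"
    by (simp only: exp_add[symmetric] exp_diff[symmetric])
  have "sqrt (w * (2 * v - w)) * sqrt (2 * pi * ?u) = sqrt (w * (2 * v - w) * (2 * pi * ?u))"
    by (rule real_sqrt_mult[symmetric])
  also have "w * (2 * v - w) * (2 * pi * ?u) = w\<^sup>2 * (2 * pi * v)"
    using assms by (simp add: field_simps power2_eq_square)
  also have "sqrt (w\<^sup>2 * (2 * pi * v)) = w * sqrt (2 * pi * v)"
    using assms by (subst real_sqrt_mult) simp
  finally have c: "sqrt (2 * pi * v) / (2 * pi * w) = v / (sqrt (w * (2 * v - w)) * sqrt (2 * pi * ?u))"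
    using assms by (simp add: field_simps)
  have "(normal_density 0 (sqrt w) x)\<^sup>2 / normal_density 0 (sqrt v) x
     = exp (- (x - 0)\<^sup>2 / (2 * w)) * exp (- (x - 0)\<^sup>2 / (2 * w)) / exp (- (x - 0)\<^sup>2 / (2 * v))
        * (sqrt (2 * pi * v) / (2 * pi * w))"
    using assms by (simp only: normal_density_sqrt power2_eq_square) (simp add: field_simps)
  also have "\<dots> = v / sqrt (w * (2 * v - w)) * normal_density 0 (sqrt ?u) x"
    unfolding e c normal_density_sqrt[OF u] by simp
  finally show ?thesis .
qed

text \<open>Completing the square. Read from right to left, it replaces the exponential of a square
  by an average of exponentials that are linear in \<open>a\<close>.\<close>

lemma std_normal_exp_linear:
  "has_bochner_integral lborel (\<lambda>x. std_normal_density x * exp (a * x)) (exp (a\<^sup>2 / 2))"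
proof -
  have "std_normal_density x * exp (a * x) = exp (a\<^sup>2 / 2) * normal_density a 1 x" for x
  proof -
    have "- x\<^sup>2 / 2 + a * x = a\<^sup>2 / 2 + - (x - a)\<^sup>2 / 2"
      by (simp add: field_simps power2_eq_square)
    then have "exp (- x\<^sup>2 / 2) * exp (a * x) = exp (a\<^sup>2 / 2) * exp (- (x - a)\<^sup>2 / 2)"
      by (simp only: exp_add[symmetric])
    then show ?thesis
      by (simp add: normal_density_def)
  qed
  then show ?thesis
    using has_integral_normal_density[of 1 "exp (a\<^sup>2 / 2)" a] by simp
qed

text \<open>The exponents combine to that of a Gaussian with variance \<open>1 / (1 - a)\<close>,
  whence the condition on \<open>a\<close>.\<close>

lemma std_normal_exp_square:
  assumes "a < 1"
  shows "has_bochner_integral lborel (\<lambda>x. std_normal_density x * exp (a * x\<^sup>2 / 2)) (1 / sqrt (1 - a))"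
proof -
  have "std_normal_density x * exp (a * x\<^sup>2 / 2)
      = 1 / sqrt (1 - a) * normal_density 0 (1 / sqrt (1 - a)) x" for x
  proof -
    have "- x\<^sup>2 / 2 + a * x\<^sup>2 / 2 = - x\<^sup>2 / (2 * (1 / sqrt (1 - a))\<^sup>2)"
      using assms by (simp add: field_simps)
    then have "exp (- x\<^sup>2 / 2) * exp (a * x\<^sup>2 / 2) = exp (- x\<^sup>2 / (2 * (1 / sqrt (1 - a))\<^sup>2))"
      by (simp only: exp_add[symmetric])
    then show ?thesis
      using assms by (simp add: normal_density_def real_sqrt_divide power_divide)
  qed
  then show ?thesis
    using has_integral_normal_density[of "1 / sqrt (1 - a)" "1 / sqrt (1 - a)" 0] assms by simp
qed

section \<open>The Gaussian mixture of a single channel use\<close>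

lemma mean_mult: "mean A f * mean A g = mean A (\<lambda>s. mean A (\<lambda>s'. f s * g s'))"
  by (simp add: mean_def sum_product sum_divide_distrib)

lemma mean_mult_right: "mean A f * c = mean A (\<lambda>s. f s * c)"
  by (simp add: mean_def sum_distrib_right)

lemma mean_divide: "mean A f / c = mean A (\<lambda>s. f s / c)"
  by (simp add: mean_def sum_divide_distrib mult.commute)

lemma mean_nonneg: "(\<And>s. s \<in> words A \<Longrightarrow> 0 \<le> f s) \<Longrightarrow> 0 \<le> mean A f"
  unfolding mean_def by (intro divide_nonneg_nonneg sum_nonneg) auto

lemma borel_measurable_mean[measurable (raw)]:
  "(\<And>s. s \<in> words A \<Longrightarrow> f s \<in> borel_measurable M) \<Longrightarrow> (\<lambda>x. mean A (\<lambda>s. f s x)) \<in> borel_measurable M"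
  unfolding mean_def by (intro borel_measurable_divide borel_measurable_sum) auto

definition signal_density :: "'b set \<Rightarrow> ('b \<Rightarrow> real) \<Rightarrow> real \<Rightarrow> real \<Rightarrow> real" where
  "signal_density A \<beta> v x = mean A (\<lambda>s. normal_density (level A \<beta> s) (sqrt v) x)"

lemma signal_density_nonneg: "0 \<le> signal_density A \<beta> v x"
  by (simp add: signal_density_def mean_nonneg)

lemma borel_measurable_signal_density[measurable]: "signal_density A \<beta> v \<in> borel_measurable borel"
  unfolding signal_density_def[abs_def] by measurable

lemma has_integral_signal_density:
  assumes "finite A" "0 < v"
  shows "has_bochner_integral lborel (signal_density A \<beta> v) 1"
  using has_integral_mean[OF assms(1), of "\<lambda>s. normal_density (level A \<beta> s) (sqrt v)" "\<lambda>_. 1"] assms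
  by (simp add: signal_density_def[abs_def] has_bochner_integral_iff mean_const)

section \<open>Chi-square bound for the mixture against the Gaussian of equal variance\<close>

context
  fixes A :: "'b set" and \<beta> :: "'b \<Rightarrow> real" and v p\<^sub>2 p\<^sub>4 :: real
  assumes fin: "finite A" and v: "0 < v"
  defines "p\<^sub>2 \<equiv> \<Sum>i\<in>A. (\<beta> i)\<^sup>2" and "p\<^sub>4 \<equiv> \<Sum>i\<in>A. \<beta> i ^ 4"
  assumes small: "p\<^sub>2 \<le> v / 2"
begin

lemma p\<^sub>2_nonneg: "0 \<le> p\<^sub>2"
  unfolding p\<^sub>2_def by (intro sum_nonneg) auto

lemma p\<^sub>4_nonneg: "0 \<le> p\<^sub>4"
  unfolding p\<^sub>4_def by (intro sum_nonneg) auto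

text \<open>Expanding the square gives three kinds of quotient. The denominator shares the variance
  of the mixture components, so each quotient is built from multiples of single normal densities.
  Hypothesis \<open>small\<close> keeps \<open>v + p\<^sub>2\<close> below \<open>2 * v\<close>,
  which the last quotient needs.\<close>

lemma has_integral_signal_density_diff:
  "has_bochner_integral lborel
    (\<lambda>x. (signal_density A \<beta> v x - normal_density 0 (sqrt (v + p\<^sub>2)) x)\<^sup>2 / normal_density 0 (sqrt v) x)
    (mean A (\<lambda>s. mean A (\<lambda>s'. exp (level A \<beta> s * level A \<beta> s' / v)))
      - 2 * mean A (\<lambda>s. exp ((level A \<beta> s)\<^sup>2 * p\<^sub>2 / (2 * v\<^sup>2)))
      + 1 / sqrt (1 - (p\<^sub>2 / v)\<^sup>2))"
proof -
  define w where "w = v + p\<^sub>2"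
  have w: "0 < w" "w < 2 * v"
    using v p\<^sub>2_nonneg small by (auto simp: w_def)
  define c where "c = level A \<beta>"
  let ?n = "\<lambda>s. normal_density (c s) (sqrt v)" and ?r = "normal_density 0 (sqrt v)"
    and ?q = "normal_density 0 (sqrt w)"
  have "has_bochner_integral lborel (\<lambda>x. mean A (\<lambda>s. mean A (\<lambda>s'. ?n s x * ?n s' x / ?r x)))
      (mean A (\<lambda>s. mean A (\<lambda>s'. exp (c s * c s' / v))))"
    unfolding normal_density_mult_div[OF v]
    using v by (intro has_integral_mean fin has_integral_normal_density) auto
  moreover have "has_bochner_integral lborel (\<lambda>x. mean A (\<lambda>s. ?n s x * ?q x / ?r x))
      (mean A (\<lambda>s. exp ((c s)\<^sup>2 * p\<^sub>2 / (2 * v\<^sup>2))))"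
    unfolding normal_density_mult_div'[OF v w(1)]
    using v w by (simp add: w_def) (intro has_integral_mean fin has_integral_normal_density, auto)
  moreover have "has_bochner_integral lborel (\<lambda>x. (?q x)\<^sup>2 / ?r x) (1 / sqrt (1 - (p\<^sub>2 / v)\<^sup>2))"
  proof -
    \<comment> \<open>With \<open>w = v + p\<^sub>2\<close> both sides are
      \<open>v\<^sup>2 - p\<^sub>2\<^sup>2\<close>.\<close>
    have "v\<^sup>2 * (1 - (p\<^sub>2 / v)\<^sup>2) = w * (2 * v - w)"
      using v by (simp add: w_def field_simps power2_eq_square)
    then have "sqrt (w * (2 * v - w)) = v * sqrt (1 - (p\<^sub>2 / v)\<^sup>2)"
      using v real_sqrt_mult[of "v\<^sup>2" "1 - (p\<^sub>2 / v)\<^sup>2"] by simp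
    then have eq: "v / sqrt (w * (2 * v - w)) = 1 / sqrt (1 - (p\<^sub>2 / v)\<^sup>2)"
      using v by simp
    have "0 < sqrt (v * w / (2 * v - w))"
      using v w by simp
    then show ?thesis
      unfolding normal_density_square_div[OF v w] eq by (rule has_integral_normal_density)
  qed
  ultimately have "has_bochner_integral lborel
     (\<lambda>x. mean A (\<lambda>s. mean A (\<lambda>s'. ?n s x * ?n s' x / ?r x)) - 2 * mean A (\<lambda>s. ?n s x * ?q x / ?r x) + (?q x)\<^sup>2 / ?r x)
     (mean A (\<lambda>s. mean A (\<lambda>s'. exp (c s * c s' / v))) - 2 * mean A (\<lambda>s. exp ((c s)\<^sup>2 * p\<^sub>2 / (2 * v\<^sup>2)))
      + 1 / sqrt (1 - (p\<^sub>2 / v)\<^sup>2))"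
    by (intro has_bochner_integral_add has_bochner_integral_diff has_bochner_integral_mult_right)
  moreover have "mean A (\<lambda>s. mean A (\<lambda>s'. ?n s x * ?n s' x / ?r x)) - 2 * mean A (\<lambda>s. ?n s x * ?q x / ?r x) + (?q x)\<^sup>2 / ?r x
     = (mean A (\<lambda>s. ?n s x) - ?q x)\<^sup>2 / ?r x" for x
    by (simp add: mean_divide[symmetric] mean_mult[symmetric] mean_mult_right[symmetric])
      (simp add: power2_eq_square algebra_simps add_divide_distrib diff_divide_distrib)
  ultimately show ?thesis
    by (simp add: signal_density_def w_def c_def)
qed

text \<open>
  The double mean is at most the single one because \<open>cosh x \<le> exp (x\<^sup>2 / 2)\<close>. What remains is
  linearized by \<open>exp (a\<^sup>2 / 2) = E (exp (a G))\<close> with \<open>G\<close> standard normal, so that the mean over words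
  factorizes into hyperbolic cosines, which agree with \<open>exp (x\<^sup>2 / 2)\<close> up to order four.
\<close>

lemma integral_signal_density_diff_le:
  "mean A (\<lambda>s. mean A (\<lambda>s'. exp (level A \<beta> s * level A \<beta> s' / v)))
      - 2 * mean A (\<lambda>s. exp ((level A \<beta> s)\<^sup>2 * p\<^sub>2 / (2 * v\<^sup>2)))
      + 1 / sqrt (1 - (p\<^sub>2 / v)\<^sup>2)
    \<le> 32 * (p\<^sub>2 / v\<^sup>2)\<^sup>2 * p\<^sub>4"
proof -
  define c where "c = level A \<beta>"
  define a where "a = (p\<^sub>2 / v)\<^sup>2"
  have "p\<^sub>2 / v \<le> 1 / 2"
    using small v by (simp add: field_simps)
  then have a: "a \<le> 1 / 4"
    using power_mono[of "p\<^sub>2 / v" "1 / 2" 2] p\<^sub>2_nonneg v by (simp add: a_def power_divide)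
  \<comment> \<open>Chosen so that \<open>(\<tau> * c s)\<^sup>2 / 2\<close> is the exponent in the
    single mean. Also \<open>\<tau>\<^sup>2 * p\<^sub>2 = a\<close>, so the exponential that matches
    the product of cosh is \<open>exp (a * x\<^sup>2 / 2)\<close>.\<close>
  define \<tau> where "\<tau> = sqrt p\<^sub>2 / v"
  have \<tau>2: "\<tau>\<^sup>2 = p\<^sub>2 / v\<^sup>2"
    using p\<^sub>2_nonneg by (simp add: \<tau>_def power_divide)
  have \<tau>4: "\<tau> ^ 4 = (p\<^sub>2 / v\<^sup>2)\<^sup>2"
    unfolding \<tau>2[symmetric] by (simp add: power2_eq_square power4_eq_xxxx)
  have a_eq: "a = \<tau>\<^sup>2 * p\<^sub>2"
    unfolding \<tau>2 by (simp add: a_def power2_eq_square)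
  have "mean A (\<lambda>s. mean A (\<lambda>s'. exp (c s * c s' / v))) \<le> mean A (\<lambda>s. exp ((c s)\<^sup>2 * p\<^sub>2 / (2 * v\<^sup>2)))"
  proof (rule mean_mono)
    fix s
    show "mean A (\<lambda>s'. exp (c s * c s' / v)) \<le> exp ((c s)\<^sup>2 * p\<^sub>2 / (2 * v\<^sup>2))"
      using mean_exp_level_le[OF fin, of "c s / v" \<beta>]
      by (simp add: c_def p\<^sub>2_def power_divide mult.commute)
  qed
  moreover have "1 / sqrt (1 - a) - mean A (\<lambda>s. exp ((c s)\<^sup>2 * p\<^sub>2 / (2 * v\<^sup>2))) \<le> 32 * (p\<^sub>2 / v\<^sup>2)\<^sup>2 * p\<^sub>4"
  proof -
    have "has_bochner_integral lborel (\<lambda>x. mean A (\<lambda>s. std_normal_density x * exp (\<tau> * c s * x)))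
        (mean A (\<lambda>s. exp ((\<tau> * c s)\<^sup>2 / 2)))"
      by (intro has_integral_mean fin std_normal_exp_linear)
    moreover have "mean A (\<lambda>s. std_normal_density x * exp (\<tau> * c s * x))
        = std_normal_density x * (\<Prod>i\<in>A. cosh (x * \<tau> * \<beta> i))" for x
      using mean_mult_right[of A "\<lambda>s. exp (\<tau> * c s * x)" "std_normal_density x"]
        mean_exp_level[OF fin, of "x * \<tau>" \<beta>]
      by (simp add: c_def mult_ac)
    moreover have "(\<tau> * c s)\<^sup>2 / 2 = (c s)\<^sup>2 * p\<^sub>2 / (2 * v\<^sup>2)" for s
      unfolding power_mult_distrib \<tau>2 by (simp add: mult.commute)
    ultimately have lower: "has_bochner_integral lborel
        (\<lambda>x. std_normal_density x * (\<Prod>i\<in>A. cosh (x * \<tau> * \<beta> i)))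
        (mean A (\<lambda>s. exp ((c s)\<^sup>2 * p\<^sub>2 / (2 * v\<^sup>2))))"
      by simp
    have upper: "has_bochner_integral lborel (\<lambda>x. std_normal_density x * exp (a * x\<^sup>2 / 2)) (1 / sqrt (1 - a))"
      using a by (intro std_normal_exp_square) simp
    \<comment> \<open>The constant 16 is 128 / 8, with 8 from the fourth-order error and 128 from
      \<open>x ^ 4 \<le> 128 * exp (x\<^sup>2 / 8)\<close>. As \<open>a \<le> 1 / 4\<close>, the two
      exponentials together stay below \<open>exp (x\<^sup>2 / 4)\<close>, which is integrable
      against the normal density.\<close>
    have bound: "has_bochner_integral lborel
        (\<lambda>x. 16 * (p\<^sub>2 / v\<^sup>2)\<^sup>2 * p\<^sub>4 * (std_normal_density x * exp (1 / 2 * x\<^sup>2 / 2)))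
        (16 * (p\<^sub>2 / v\<^sup>2)\<^sup>2 * p\<^sub>4 * (1 / sqrt (1 - 1 / 2)))"
      by (intro has_bochner_integral_mult_right std_normal_exp_square) simp
    have "1 / sqrt (1 - a) - mean A (\<lambda>s. exp ((c s)\<^sup>2 * p\<^sub>2 / (2 * v\<^sup>2)))
        \<le> 16 * (p\<^sub>2 / v\<^sup>2)\<^sup>2 * p\<^sub>4 * (1 / sqrt (1 - 1 / 2))"
    proof (rule has_integral_le[OF has_bochner_integral_diff[OF upper lower] bound])
      fix x :: real
      have "exp (a * x\<^sup>2 / 2) - (\<Prod>i\<in>A. cosh (x * \<tau> * \<beta> i)) \<le> x ^ 4 * \<tau> ^ 4 * p\<^sub>4 / 8 * exp (a * x\<^sup>2 / 2)"
        using prod_exp_minus_prod_cosh_le[OF fin, of "\<lambda>i. x * \<tau> * \<beta> i"]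
        by (simp add: power_mult_distrib sum_distrib_left[symmetric] a_eq p\<^sub>2_def[symmetric] p\<^sub>4_def[symmetric] mult_ac)
      also have "\<dots> \<le> (128 * exp (x\<^sup>2 / 8)) * \<tau> ^ 4 * p\<^sub>4 / 8 * exp (x\<^sup>2 / 8)"
      proof (intro mult_mono divide_right_mono mult_right_mono)
        have "1 + x\<^sup>2 / 8 + (x\<^sup>2 / 8)\<^sup>2 / 2 \<le> exp (x\<^sup>2 / 8)"
          by (rule exp_lower_Taylor_quadratic) simp
        moreover have "(x\<^sup>2 / 8)\<^sup>2 / 2 = x ^ 4 / 128"
          by (simp add: power2_eq_square power4_eq_xxxx)
        ultimately have "x ^ 4 / 128 \<le> exp (x\<^sup>2 / 8)"
          using zero_le_power2[of x] by linarith
        then show "x ^ 4 \<le> 128 * exp (x\<^sup>2 / 8)" by simp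
        show "exp (a * x\<^sup>2 / 2) \<le> exp (x\<^sup>2 / 8)"
          using mult_right_mono[OF a, of "x\<^sup>2"] by simp
      qed (use p\<^sub>4_nonneg in auto)
      also have "\<dots> = 16 * (p\<^sub>2 / v\<^sup>2)\<^sup>2 * p\<^sub>4 * exp (1 / 2 * x\<^sup>2 / 2)"
        using exp_add[of "x\<^sup>2 / 8" "x\<^sup>2 / 8"] unfolding \<tau>4 by simp
      finally have "std_normal_density x * (exp (a * x\<^sup>2 / 2) - (\<Prod>i\<in>A. cosh (x * \<tau> * \<beta> i)))
          \<le> std_normal_density x * (16 * (p\<^sub>2 / v\<^sup>2)\<^sup>2 * p\<^sub>4 * exp (1 / 2 * x\<^sup>2 / 2))"
        by (rule mult_left_mono) simp
      then show "std_normal_density x * exp (a * x\<^sup>2 / 2) - std_normal_density x * (\<Prod>i\<in>A. cosh (x * \<tau> * \<beta> i))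
          \<le> 16 * (p\<^sub>2 / v\<^sup>2)\<^sup>2 * p\<^sub>4 * (std_normal_density x * exp (1 / 2 * x\<^sup>2 / 2))"
        by (simp add: right_diff_distrib mult_ac)
    qed
    also have "\<dots> \<le> 16 * (p\<^sub>2 / v\<^sup>2)\<^sup>2 * p\<^sub>4 * 2"
      using p\<^sub>4_nonneg real_sqrt_le_mono[of "1/4" "1/2"]
      by (intro mult_left_mono) (auto simp: real_sqrt_divide field_simps)
    finally show ?thesis by simp
  qed
  \<comment> \<open>The expression is the double mean minus the single one, at most zero, plus
    \<open>1 / sqrt (1 - a)\<close> minus the single one.\<close>
  ultimately show ?thesis
    by (simp add: c_def a_def)
qed

text \<open>The price of changing the denominator: the exponential factor grows with the variance,
  and the normalising constants differ by a factor of at most 2 because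
  \<open>v + p\<^sub>2 \<le> 4 * v\<close>.\<close>

lemma normal_density_le_wider: "normal_density 0 (sqrt v) x \<le> 2 * normal_density 0 (sqrt (v + p\<^sub>2)) x"
proof -
  have "sqrt (2 * pi * (v + p\<^sub>2)) \<le> sqrt (2\<^sup>2 * (2 * pi * v))"
    using small v by (intro real_sqrt_le_mono) (simp add: algebra_simps)
  also have "\<dots> = 2 * sqrt (2 * pi * v)"
    by (subst real_sqrt_mult) simp
  finally have "sqrt (2 * pi * (v + p\<^sub>2)) \<le> 2 * sqrt (2 * pi * v)" .
  moreover have "1 / a \<le> 2 / b" if "0 < a" "0 < b" "b \<le> 2 * a" for a b :: real
    using that by (simp add: field_simps)
  ultimately have "1 / sqrt (2 * pi * v) \<le> 2 / sqrt (2 * pi * (v + p\<^sub>2))"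
    using v p\<^sub>2_nonneg by simp
  moreover have "exp (- x\<^sup>2 / (2 * v)) \<le> exp (- x\<^sup>2 / (2 * (v + p\<^sub>2)))"
    using v p\<^sub>2_nonneg by (auto intro!: divide_left_mono)
  ultimately have "1 / sqrt (2 * pi * v) * exp (- x\<^sup>2 / (2 * v))
      \<le> 2 / sqrt (2 * pi * (v + p\<^sub>2)) * exp (- x\<^sup>2 / (2 * (v + p\<^sub>2)))"
    using v p\<^sub>2_nonneg by (intro mult_mono) auto
  then show ?thesis
    using v p\<^sub>2_nonneg by (simp add: normal_density_sqrt)
qed

text \<open>Here \<open>L\<close> is the likelihood ratio of one channel use. The constant 64 is
  twice the 32 of \<open>integral_signal_density_diff_le\<close>, the factor 2 coming from
  \<open>normal_density_le_wider\<close>.\<close>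

lemma signal_density_ratio:
  fixes L
  defines "Q \<equiv> density lborel (\<lambda>x. ennreal (normal_density 0 (sqrt (v + p\<^sub>2)) x))"
    and "L \<equiv> \<lambda>x. signal_density A \<beta> v x / normal_density 0 (sqrt (v + p\<^sub>2)) x"
  shows "density Q (\<lambda>x. ennreal (L x)) = density lborel (\<lambda>x. ennreal (signal_density A \<beta> v x))"
    and "(\<integral>x. L x \<partial>Q) = 1"
    and "integrable Q (\<lambda>x. (L x)\<^sup>2)"
    and "(\<integral>x. (L x)\<^sup>2 \<partial>Q) \<le> 1 + 64 * (p\<^sub>2 / v\<^sup>2)\<^sup>2 * p\<^sub>4"
proof -
  let ?p = "signal_density A \<beta> v" and ?q = "normal_density 0 (sqrt (v + p\<^sub>2))"
    and ?r = "normal_density 0 (sqrt v)"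
  let ?d = "\<lambda>x. (?p x - ?q x)\<^sup>2"
  have q: "0 < ?q x" for x
    using v p\<^sub>2_nonneg by (intro normal_density_pos) auto
  have r: "0 < ?r x" for x
    using v by (intro normal_density_pos) auto
  have qL: "?q x * L x = ?p x" for x
    using q[of x] by (simp add: L_def)
  \<comment> \<open>Expanding around \<open>?q\<close> makes the integral equal to the chi-square
    integral plus \<open>2 - 1\<close>, as both densities have mass one.\<close>
  have qL2: "?q x * (L x)\<^sup>2 = ?d x / ?q x + 2 * ?p x - ?q x" for x
    using q[of x] by (simp add: L_def field_simps power2_eq_square)
  have L_meas[measurable]: "L \<in> borel_measurable borel"
    unfolding L_def by measurable
  show "density Q (\<lambda>x. ennreal (L x)) = density lborel (\<lambda>x. ennreal (?p x))"
    unfolding Q_def by (subst density_density_eq) (auto simp: qL ennreal_mult'[symmetric])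
  show "(\<integral>x. L x \<partial>Q) = 1"
    unfolding Q_def using has_integral_signal_density[OF fin v, of \<beta>]
    by (subst integral_real_density) (auto simp: qL has_bochner_integral_iff)
  note D = has_integral_signal_density_diff
  have D2: "integrable lborel (\<lambda>x. 2 * (?d x / ?r x))"
    using has_bochner_integral_mult_right[OF D, of 2] by (rule integrable.intros)
  have pt: "?d x / ?q x \<le> 2 * (?d x / ?r x)" for x
  proof -
    have "1 / ?q x \<le> 2 / ?r x"
      using normal_density_le_wider[of x] q[of x] r[of x] by (simp add: field_simps)
    from mult_left_mono[OF this, of "?d x"] show ?thesis
      by (simp add: mult.commute)
  qed
  have int: "integrable lborel (\<lambda>x. ?d x / ?q x)"
  proof (rule Bochner_Integration.integrable_bound)
    show "integrable lborel (\<lambda>x. 2 * (?d x / ?r x))"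
      by (fact D2)
    show "AE x in lborel. norm (?d x / ?q x) \<le> norm (2 * (?d x / ?r x))"
      using pt q r by (auto simp: less_imp_le)
  qed simp
  have "(\<integral>x. ?d x / ?q x \<partial>lborel) \<le> (\<integral>x. 2 * (?d x / ?r x) \<partial>lborel)"
    by (intro integral_mono int pt D2)
  also have "\<dots> \<le> 64 * (p\<^sub>2 / v\<^sup>2)\<^sup>2 * p\<^sub>4"
    unfolding has_bochner_integral_integral_eq[OF has_bochner_integral_mult_right[OF D, of 2]]
    using integral_signal_density_diff_le by simp
  finally have le: "(\<integral>x. ?d x / ?q x \<partial>lborel) \<le> 64 * (p\<^sub>2 / v\<^sup>2)\<^sup>2 * p\<^sub>4" .
  have "0 < sqrt (v + p\<^sub>2)"
    using v p\<^sub>2_nonneg by simp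
  then have total: "has_bochner_integral lborel (\<lambda>x. ?q x * (L x)\<^sup>2) ((\<integral>x. ?d x / ?q x \<partial>lborel) + 2 * 1 - 1)"
    unfolding qL2 using int
    by (intro has_bochner_integral_add has_bochner_integral_diff has_bochner_integral_mult_right
        has_integral_signal_density fin v) (auto simp: has_bochner_integral_iff)
  show "integrable Q (\<lambda>x. (L x)\<^sup>2)"
    unfolding Q_def using total by (subst integrable_real_density) (auto simp: has_bochner_integral_iff)
  show "(\<integral>x. (L x)\<^sup>2 \<partial>Q) \<le> 1 + 64 * (p\<^sub>2 / v\<^sup>2)\<^sup>2 * p\<^sub>4"
    unfolding Q_def using total le by (subst integral_real_density) (auto simp: has_bochner_integral_iff)
qed

end

section \<open>The joint law of output and message\<close>

lemma flip_word:
  "m \<in> words A \<Longrightarrow> s \<in> words A \<Longrightarrow> (\<lambda>i\<in>A. (m i + s i) mod 2) \<in> words A"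
  by (auto simp: words_def PiE_iff)

text \<open>Masking with uniform secrets hides the message: for a fixed message word the signal is still
  distributed as for uniform bits.\<close>

lemma mean_level_flip:
  fixes h :: "real \<Rightarrow> real"
  assumes m: "m \<in> words A"
  shows "mean A (\<lambda>s. h (\<Sum>i\<in>A. \<beta> i * (-1) ^ (m i + s i))) = mean A (\<lambda>s. h (level A \<beta> s))"
proof -
  \<comment> \<open>Adding \<open>m\<close> modulo 2 is an involution on words; the restriction to
    \<open>A\<close> keeps the result extensional.\<close>
  let ?f = "\<lambda>s. \<lambda>i\<in>A. (m i + s i) mod 2"
  have bit: "m i = 0 \<or> m i = 1" if "i \<in> A" for i
    using m that by (auto simp: words_def PiE_iff)
  have inv: "?f (?f s) = s" if "s \<in> words A" for s
  proof (rule extensionalityI[of _ A])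
    show "s \<in> extensional A"
      using that by (simp add: words_def PiE_iff)
    fix i assume i: "i \<in> A"
    then have "s i = 0 \<or> s i = 1"
      using that by (auto simp: words_def PiE_iff)
    with i bit[OF i] show "?f (?f s) i = s i"
      by auto
  qed simp
  have "(\<Sum>s\<in>words A. h (\<Sum>i\<in>A. \<beta> i * (-1) ^ (m i + s i))) = (\<Sum>s\<in>words A. h (level A \<beta> s))"
  proof (rule sum.reindex_bij_witness[of _ ?f ?f])
    fix s assume s: "s \<in> words A"
    show "?f (?f s) = s" by (fact inv[OF s])
    show "?f s \<in> words A" by (fact flip_word[OF m s])
    have "(-1 :: real) ^ ((m i + s i) mod 2) = (-1) ^ (m i + s i)" for i
      by (simp add: minus_one_power_iff)
    then show "h (level A \<beta> (?f s)) = h (\<Sum>i\<in>A. \<beta> i * (-1) ^ (m i + s i))"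
      by (simp add: level_def)
  qed (use inv flip_word[OF m] in auto)
  then show ?thesis
    by (simp add: mean_def)
qed

lemma measure_signal_density:
  assumes "finite A" "0 < v" "E \<in> sets borel"
  shows "measure (density lborel (\<lambda>x. ennreal (signal_density A \<beta> v x))) E
    = mean A (\<lambda>s. measure (density lborel (\<lambda>x. ennreal (normal_density (level A \<beta> s) (sqrt v) x))) E)"
proof -
  have eq: "measure (density lborel (\<lambda>x. ennreal (f x))) E = (\<integral>x. f x * indicator E x \<partial>lborel)"
    if "f \<in> borel_measurable borel" "\<And>x. 0 \<le> f x" for f :: "real \<Rightarrow> real"
    using that assms(3)
    by (simp add: measure_def emeasure_density integral_eq_nn_integral ennreal_mult' flip: ennreal_indicator)
  have "has_bochner_integral lborel (\<lambda>x. mean A (\<lambda>s. normal_density (level A \<beta> s) (sqrt v) x * indicator E x))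
     (mean A (\<lambda>s. \<integral>x. normal_density (level A \<beta> s) (sqrt v) x * indicator E x \<partial>lborel))"
    using assms
    by (intro has_integral_mean) (auto simp: has_bochner_integral_iff intro!: integrable_real_mult_indicator)
  then show ?thesis
    by (subst (1 2) eq)
      (auto simp: signal_density_nonneg signal_density_def[symmetric] mean_mult_right[symmetric] has_bochner_integral_iff)
qed

section \<open>Independence of the sources and the law of the output\<close>

context willie_channel
begin

abbreviation sources :: "source set" where
  "sources \<equiv> {Message} \<union> {Secret i j | i j. i \<in> A \<and> j \<in> {1..n}} \<union> {Noise j | j. j \<in> {1..n}}"

lemma M_words: "\<omega> \<in> space \<Omega> \<Longrightarrow> M \<omega> \<in> words A"
  using measurable_space[OF M_random] by (simp add: message_space_def space_PiM words_def)

lemma S_bit: "\<lbrakk>i \<in> A; j \<in> {1..n}; \<omega> \<in> space \<Omega>\<rbrakk> \<Longrightarrow> S i j \<omega> \<in> {0, 1}"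
  using measurable_space[OF S_random] by simp

text \<open>Independence is applied to one event per source; the fair secrets of one channel use
  together contribute \<open>1 / 2 ^ card A\<close>.\<close>

lemma prob_source_values:
  assumes "finite A" and B: "B \<in> sets (message_space A)"
    and s: "\<And>i j. i \<in> A \<Longrightarrow> j \<in> {1..n} \<Longrightarrow> s j i \<in> {0, 1}"
    and E: "\<And>j. j \<in> {1..n} \<Longrightarrow> E j \<in> sets borel"
  shows "prob {\<omega> \<in> space \<Omega>. M \<omega> \<in> B \<and> (\<forall>j\<in>{1..n}. (\<forall>i\<in>A. S i j \<omega> = s j i) \<and> N j \<omega> \<in> E j)}
    = prob {\<omega> \<in> space \<Omega>. M \<omega> \<in> B} * (\<Prod>j\<in>{1..n}. prob {\<omega> \<in> space \<Omega>. N j \<omega> \<in> E j} / 2 ^ card A)"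
proof -
  \<comment> \<open>Sources of different types are merged into one family of events indexed by
    \<open>source\<close>, to which \<open>indep_sets\<close> applies.\<close>
  define F where "F = (\<lambda>r. case r of Message \<Rightarrow> M -` B \<inter> space \<Omega>
      | Secret i j \<Rightarrow> S i j -` {s j i} \<inter> space \<Omega> | Noise j \<Rightarrow> N j -` E j \<inter> space \<Omega>)"
  have S_half: "prob (S i j -` {s j i} \<inter> space \<Omega>) = 1 / 2" if "i \<in> A" "j \<in> {1..n}" for i j
  proof -
    have "prob (S i j -` {s j i} \<inter> space \<Omega>) = measure (distr \<Omega> (count_space {0, 1}) (S i j)) {s j i}"
      using S_random[OF that] s[OF that] by (subst measure_distr) auto
    also have "\<dots> = 1 / 2"
      unfolding S_uniform[OF that] using s[OF that] by (subst measure_uniform_count_measure) auto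
    finally show ?thesis .
  qed
  have sources: "sources = insert Message ((\<lambda>(j, i). Secret i j) ` ({1..n} \<times> A) \<union> Noise ` {1..n})"
    by auto
  have fin: "finite sources"
    unfolding sources using \<open>finite A\<close> by simp
  have "prob (\<Inter>r\<in>sources. F r) = (\<Prod>r\<in>sources. prob (F r))"
  proof (rule indep_setsD[OF independent order_refl _ fin])
    show "\<forall>r\<in>sources. F r \<in> source_events \<Omega> A M S N r"
      using B s E by (fastforce simp: F_def)
  qed simp
  also have "(\<Inter>r\<in>sources. F r)
      = F Message \<inter> (\<Inter>j\<in>{1..n}. \<Inter>i\<in>A. F (Secret i j)) \<inter> (\<Inter>j\<in>{1..n}. F (Noise j))"
    unfolding sources by auto
  also have "\<dots> = {\<omega> \<in> space \<Omega>. M \<omega> \<in> B \<and> (\<forall>j\<in>{1..n}. (\<forall>i\<in>A. S i j \<omega> = s j i) \<and> N j \<omega> \<in> E j)}"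
    by (auto simp: F_def)
  also have "(\<Prod>r\<in>sources. prob (F r))
      = prob (F Message) * ((\<Prod>(j, i)\<in>{1..n} \<times> A. prob (F (Secret i j))) * (\<Prod>j\<in>{1..n}. prob (F (Noise j))))"
  proof -
    let ?S = "(\<lambda>(j, i). Secret i j) ` ({1..n} \<times> A)" and ?T = "Noise ` {1..n}"
    have "(\<Prod>r\<in>sources. prob (F r)) = prob (F Message) * (\<Prod>r\<in>?S \<union> ?T. prob (F r))"
      unfolding sources using \<open>finite A\<close> by (subst prod.insert) auto
    also have "(\<Prod>r\<in>?S \<union> ?T. prob (F r)) = (\<Prod>r\<in>?S. prob (F r)) * (\<Prod>r\<in>?T. prob (F r))"
      using \<open>finite A\<close> by (intro prod.union_disjoint) auto
    also have "(\<Prod>r\<in>?S. prob (F r)) = (\<Prod>(j, i)\<in>{1..n} \<times> A. prob (F (Secret i j)))"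
      by (subst prod.reindex) (auto simp: inj_on_def case_prod_beta)
    also have "(\<Prod>r\<in>?T. prob (F r)) = (\<Prod>j\<in>{1..n}. prob (F (Noise j)))"
      by (subst prod.reindex) (auto simp: inj_on_def)
    finally show ?thesis .
  qed
  also have "(\<Prod>(j, i)\<in>{1..n} \<times> A. prob (F (Secret i j))) = (\<Prod>j\<in>{1..n}. 1 / 2 ^ card A)"
    by (subst prod.cartesian_product[symmetric]) (simp add: F_def S_half power_divide)
  also have "\<dots> * (\<Prod>j\<in>{1..n}. prob (F (Noise j))) = (\<Prod>j\<in>{1..n}. prob (F (Noise j)) / 2 ^ card A)"
    by (simp only: prod.distrib[symmetric]) simp
  finally show ?thesis
    by (simp add: F_def vimage_def Int_def conj_commute)
qed

lemma prob_noise_shift: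
  assumes "j \<in> {1..n}" "0 < v\<^sub>W" "E \<in> sets borel"
  shows "prob {\<omega> \<in> space \<Omega>. N j \<omega> + c \<in> E}
    = measure (density lborel (\<lambda>x. ennreal (normal_density c (sqrt v\<^sub>W) x))) E"
proof -
  have "distributed \<Omega> lborel (\<lambda>\<omega>. c + 1 * N j \<omega>) (normal_density (c + 1 * 0) (\<bar>1\<bar> * sqrt v\<^sub>W))"
    using assms by (intro normal_density_affine N_gaussian) auto
  then have d: "distributed \<Omega> lborel (\<lambda>\<omega>. N j \<omega> + c) (normal_density c (sqrt v\<^sub>W))"
    by (simp add: add.commute)
  have "prob {\<omega> \<in> space \<Omega>. N j \<omega> + c \<in> E} = measure (distr \<Omega> lborel (\<lambda>\<omega>. N j \<omega> + c)) E"
    using distributed_measurable[OF d] assms(3) by (subst measure_distr) (auto intro!: arg_cong[where f = prob])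
  then show ?thesis
    by (simp add: distributed_distr_eq_density[OF d])
qed

lemma noise_random: "j \<in> {1..n} \<Longrightarrow> random_variable borel (N j)"
  using distributed_measurable[OF N_gaussian] by simp

lemma source_values_event:
  assumes "finite A" and B: "B \<in> sets (message_space A)"
    and s: "\<And>i j. i \<in> A \<Longrightarrow> j \<in> {1..n} \<Longrightarrow> s j i \<in> {0, 1}"
    and E: "\<And>j. j \<in> {1..n} \<Longrightarrow> E j \<in> sets borel"
  shows "{\<omega> \<in> space \<Omega>. M \<omega> \<in> B \<and> (\<forall>j\<in>{1..n}. (\<forall>i\<in>A. S i j \<omega> = s j i) \<and> N j \<omega> \<in> E j)} \<in> events"
proof -
  have "{\<omega> \<in> space \<Omega>. M \<omega> \<in> B} \<in> events"
    using measurable_sets[OF M_random B] by (simp add: vimage_def Int_def conj_commute)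
  moreover have "{\<omega> \<in> space \<Omega>. S i j \<omega> = s j i} \<in> events" if "i \<in> A" "j \<in> {1..n}" for i j
    using measurable_sets[OF S_random[OF that], of "{s j i}"] s[OF that]
    by (simp add: vimage_def Int_def conj_commute)
  moreover have "{\<omega> \<in> space \<Omega>. N j \<omega> \<in> E j} \<in> events" if "j \<in> {1..n}" for j
    using measurable_sets[OF noise_random[OF that] E[OF that]] by (simp add: vimage_def Int_def conj_commute)
  ultimately show ?thesis
    using \<open>finite A\<close>
    by (intro sets.sets_Collect_conj sets.sets_Collect_finite_All) auto
qed

lemma received_random:
  assumes j: "j \<in> {1..n}"
  shows "random_variable borel (received n A b M S N j)"
proof -
  have "(\<lambda>\<omega>. (-1 :: real) ^ M \<omega> i) \<in> borel_measurable \<Omega>" if "i \<in> A" for i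
    using measurable_compose[OF measurable_compose[OF M_random[unfolded message_space_def]
        measurable_component_singleton[OF that]], of "\<lambda>k. (-1 :: real) ^ k" borel] by simp
  moreover have "(\<lambda>\<omega>. (-1 :: real) ^ S i j \<omega>) \<in> borel_measurable \<Omega>" if "i \<in> A" for i
    using measurable_compose[OF S_random[OF that j], of "\<lambda>k. (-1 :: real) ^ k" borel] by simp
  ultimately have "(\<lambda>\<omega>. \<Sum>i\<in>A. b i * ((-1) ^ M \<omega> i * (-1) ^ S i j \<omega>)) \<in> borel_measurable \<Omega>"
    by (intro borel_measurable_sum borel_measurable_times borel_measurable_const) auto
  then show ?thesis
    unfolding received_def[abs_def] power_add
    by (intro borel_measurable_add noise_random[OF j] borel_measurable_times borel_measurable_const)
qed

text \<open>Once the message and all secrets are fixed, the signal is constant and an output event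
  is a noise event. Summing over the secrets restores the mixture, and
  \<open>mean_level_flip\<close> removes its dependence on the message word.\<close>

lemma prob_received:
  assumes fin: "finite A" and v: "0 < v\<^sub>W" and B: "B \<in> sets (message_space A)"
    and E: "\<And>j. j \<in> {1..n} \<Longrightarrow> E j \<in> sets borel"
  shows "prob {\<omega> \<in> space \<Omega>. M \<omega> \<in> B \<and> (\<forall>j\<in>{1..n}. received n A b M S N j \<omega> \<in> E j)}
    = prob {\<omega> \<in> space \<Omega>. M \<omega> \<in> B}
      * (\<Prod>j\<in>{1..n}. measure (density lborel (\<lambda>x. ennreal (signal_density A (\<lambda>i. b i / sqrt (real n)) v\<^sub>W x))) (E j))"
    (is "_ = _ * (\<Prod>j\<in>_. ?\<mu> j)")
proof -
  define c where "c m s = (\<Sum>i\<in>A. b i / sqrt (real n) * (-1) ^ (m i + s i))" for m s :: "nat \<Rightarrow> nat"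
  define g where "g m j s = measure (density lborel (\<lambda>x. ennreal (normal_density (c m s) (sqrt v\<^sub>W) x))) (E j)"
    for m s j
  define W where "W = (\<Pi>\<^sub>E j\<in>{1..n}. words A)"
  \<comment> \<open>The pieces of the event: message word \<open>m\<close>, secret word
    \<open>\<sigma> j\<close> in use \<open>j\<close>, and noise in \<open>E j\<close> shifted by
    the signal then known.\<close>
  define K where "K = (\<lambda>(m, \<sigma>). {\<omega> \<in> space \<Omega>. M \<omega> \<in> {m} \<and>
    (\<forall>j\<in>{1..n}. (\<forall>i\<in>A. S i j \<omega> = \<sigma> j i) \<and> N j \<omega> \<in> {y. y + c m (\<sigma> j) \<in> E j})})"
  have m_sets: "{m} \<in> sets (message_space A)" if "m \<in> words A" for m
  proof -
    have "{m} = (\<Pi>\<^sub>E i\<in>A. {m i})"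
      using that by (intro PiE_singleton[symmetric]) (simp add: words_def PiE_def)
    also have "\<dots> \<in> sets (message_space A)"
      using that fin unfolding message_space_def by (intro sets_PiM_I_finite) (auto simp: words_def)
    finally show ?thesis .
  qed
  have bits: "\<sigma> j i \<in> {0, 1}" if "\<sigma> \<in> W" "i \<in> A" "j \<in> {1..n}" for \<sigma> i j
    using that by (auto simp: W_def words_def PiE_iff)
  have E': "{y. y + c m (\<sigma> j) \<in> E j} \<in> sets borel" if "j \<in> {1..n}" for m \<sigma> j
    using measurable_sets[of "\<lambda>y. y + c m (\<sigma> j)" borel borel "E j"] E[OF that] by (simp add: vimage_def)
  have prob_K: "prob (K (m, \<sigma>)) = prob {\<omega> \<in> space \<Omega>. M \<omega> \<in> {m}} * (\<Prod>j\<in>{1..n}. g m j (\<sigma> j) / 2 ^ card A)"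
    if "m \<in> words A" "\<sigma> \<in> W" for m \<sigma>
    unfolding K_def prod.case
    by (subst prob_source_values[OF fin m_sets[OF that(1)] bits[OF that(2)] E'])
      (auto simp: g_def prob_noise_shift v E)
  have fins: "finite (words A)" "finite W"
    using finite_words[OF fin] by (auto simp: W_def intro!: finite_PiE)
  have received_eq: "received n A b M S N j \<omega> = N j \<omega> + c (M \<omega>) (\<lambda>i\<in>A. S i j \<omega>)" for j \<omega>
    by (simp add: received_def c_def sum_distrib_left)
  have c_cong: "c m s = c m s'" if "\<And>i. i \<in> A \<Longrightarrow> s i = s' i" for m s s'
    using that by (simp add: c_def)
  have "{\<omega> \<in> space \<Omega>. M \<omega> \<in> B \<and> (\<forall>j\<in>{1..n}. received n A b M S N j \<omega> \<in> E j)}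
      = (\<Union>k\<in>(words A \<inter> B) \<times> W. K k)"
  proof (intro equalityI subsetI)
    fix \<omega> assume "\<omega> \<in> {\<omega> \<in> space \<Omega>. M \<omega> \<in> B \<and> (\<forall>j\<in>{1..n}. received n A b M S N j \<omega> \<in> E j)}"
    then have \<omega>: "\<omega> \<in> space \<Omega>" "M \<omega> \<in> B" "\<And>j. j \<in> {1..n} \<Longrightarrow> received n A b M S N j \<omega> \<in> E j"
      by auto
    define \<sigma> where "\<sigma> = (\<lambda>j\<in>{1..n}. \<lambda>i\<in>A. S i j \<omega>)"
    have "\<sigma> \<in> W"
      using S_bit[OF _ _ \<omega>(1)] by (auto simp: \<sigma>_def W_def words_def)
    moreover have "\<omega> \<in> K (M \<omega>, \<sigma>)"
      using \<omega> by (auto simp: K_def \<sigma>_def received_eq)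
    ultimately show "\<omega> \<in> (\<Union>k\<in>(words A \<inter> B) \<times> W. K k)"
      using M_words[OF \<omega>(1)] \<omega>(2) by blast
  next
    fix \<omega> assume "\<omega> \<in> (\<Union>k\<in>(words A \<inter> B) \<times> W. K k)"
    then obtain m \<sigma> where k: "m \<in> B" "\<sigma> \<in> W" "\<omega> \<in> K (m, \<sigma>)"
      by auto
    have "c (M \<omega>) (\<lambda>i\<in>A. S i j \<omega>) = c m (\<sigma> j)" if "j \<in> {1..n}" for j
      using k(3) that by (auto simp: K_def intro!: c_cong)
    then show "\<omega> \<in> {\<omega> \<in> space \<Omega>. M \<omega> \<in> B \<and> (\<forall>j\<in>{1..n}. received n A b M S N j \<omega> \<in> E j)}"
      using k by (auto simp: K_def received_eq)
  qed
  also have "prob \<dots> = (\<Sum>k\<in>(words A \<inter> B) \<times> W. prob (K k))"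
  proof (rule finite_measure_finite_Union)
    show "K ` ((words A \<inter> B) \<times> W) \<subseteq> events"
      using source_values_event[OF fin m_sets bits E'] by (auto simp: K_def)
    show "disjoint_family_on K ((words A \<inter> B) \<times> W)"
      unfolding disjoint_family_on_def
    proof (intro ballI impI)
      fix k k' assume *: "k \<in> (words A \<inter> B) \<times> W" "k' \<in> (words A \<inter> B) \<times> W" "k \<noteq> k'"
      show "K k \<inter> K k' = {}"
      proof (rule ccontr)
        assume "K k \<inter> K k' \<noteq> {}"
        then obtain \<omega> where "\<omega> \<in> K k" "\<omega> \<in> K k'" by auto
        then have fst: "fst k = fst k'"
          and snd: "\<And>j i. j \<in> {1..n} \<Longrightarrow> i \<in> A \<Longrightarrow> snd k j i = snd k' j i"
          by (auto simp: K_def split_beta)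
        have ext: "snd k \<in> (\<Pi>\<^sub>E j\<in>{1..n}. words A)" "snd k' \<in> (\<Pi>\<^sub>E j\<in>{1..n}. words A)"
          using * by (auto simp: W_def)
        have "snd k = snd k'"
        proof (rule PiE_ext[OF ext])
          fix j assume j: "j \<in> {1..n}"
          then have "snd k j \<in> words A" "snd k' j \<in> words A"
            using ext by (auto simp: PiE_iff)
          then show "snd k j = snd k' j"
            unfolding words_def by (rule PiE_ext) (fact snd[OF j])
        qed
        with fst * show False by (auto simp: prod_eq_iff)
      qed
    qed
  qed (use fins in auto)
  also have "\<dots> = (\<Sum>m\<in>words A \<inter> B. \<Sum>\<sigma>\<in>W. prob {\<omega> \<in> space \<Omega>. M \<omega> \<in> {m}} * (\<Prod>j\<in>{1..n}. g m j (\<sigma> j) / 2 ^ card A))"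
    unfolding sum.cartesian_product
  proof (rule sum.cong[OF refl])
    fix k assume "k \<in> (words A \<inter> B) \<times> W"
    then obtain m \<sigma> where k: "k = (m, \<sigma>)" "m \<in> words A" "\<sigma> \<in> W"
      by auto
    show "prob (K k) = (case k of (m, \<sigma>) \<Rightarrow>
        prob {\<omega> \<in> space \<Omega>. M \<omega> \<in> {m}} * (\<Prod>j\<in>{1..n}. g m j (\<sigma> j) / 2 ^ card A))"
      unfolding k(1) prod.case by (rule prob_K[OF k(2,3)])
  qed
  also have "\<dots> = (\<Sum>m\<in>words A \<inter> B. prob {\<omega> \<in> space \<Omega>. M \<omega> \<in> {m}} * (\<Prod>j\<in>{1..n}. ?\<mu> j))"
  proof (rule sum.cong[OF refl])
    fix m assume m: "m \<in> words A \<inter> B"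
    \<comment> \<open>The secret words of different uses vary independently, so the sum over all
      arrays factors into one sum per use.\<close>
    have "(\<Sum>\<sigma>\<in>W. \<Prod>j\<in>{1..n}. g m j (\<sigma> j) / 2 ^ card A) = (\<Prod>j\<in>{1..n}. \<Sum>s\<in>words A. g m j s / 2 ^ card A)"
      unfolding W_def using fins by (subst prod_sum_PiE) auto
    also have "\<dots> = (\<Prod>j\<in>{1..n}. ?\<mu> j)"
    proof (rule prod.cong[OF refl])
      fix j assume "j \<in> {1..n}"
      have "(\<Sum>s\<in>words A. g m j s / 2 ^ card A) = mean A (g m j)"
        by (simp add: mean_def sum_divide_distrib)
      also have "\<dots> = ?\<mu> j"
        unfolding g_def c_def measure_signal_density[OF fin v E[OF \<open>j \<in> {1..n}\<close>]]
        using m by (intro mean_level_flip[of m A "\<lambda>x. measure (density lborel (\<lambda>y. ennreal (normal_density x (sqrt v\<^sub>W) y))) (E j)"]) auto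
      finally show "(\<Sum>s\<in>words A. g m j s / 2 ^ card A) = ?\<mu> j" .
    qed
    finally show "(\<Sum>\<sigma>\<in>W. prob {\<omega> \<in> space \<Omega>. M \<omega> \<in> {m}} * (\<Prod>j\<in>{1..n}. g m j (\<sigma> j) / 2 ^ card A))
        = prob {\<omega> \<in> space \<Omega>. M \<omega> \<in> {m}} * (\<Prod>j\<in>{1..n}. ?\<mu> j)"
      by (simp only: sum_distrib_left[symmetric])
  qed
  also have "\<dots> = (\<Sum>m\<in>words A \<inter> B. prob {\<omega> \<in> space \<Omega>. M \<omega> \<in> {m}}) * (\<Prod>j\<in>{1..n}. ?\<mu> j)"
    by (simp only: sum_distrib_right)
  also have "(\<Sum>m\<in>words A \<inter> B. prob {\<omega> \<in> space \<Omega>. M \<omega> \<in> {m}})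
      = prob (\<Union>m\<in>words A \<inter> B. {\<omega> \<in> space \<Omega>. M \<omega> \<in> {m}})"
  proof (rule finite_measure_finite_Union[symmetric])
    show "(\<lambda>m. {\<omega> \<in> space \<Omega>. M \<omega> \<in> {m}}) ` (words A \<inter> B) \<subseteq> events"
      using measurable_sets[OF M_random m_sets] by (auto simp: vimage_def Int_def conj_commute)
  qed (use fins in \<open>auto simp: disjoint_family_on_def\<close>)
  also have "(\<Union>m\<in>words A \<inter> B. {\<omega> \<in> space \<Omega>. M \<omega> \<in> {m}}) = {\<omega> \<in> space \<Omega>. M \<omega> \<in> B}"
    using M_words by auto
  finally show ?thesis .
qed

text \<open>Rectangles \<open>X \<times> B\<close> determine the joint law. As
  \<open>prob_received\<close> treats only boxes in place of \<open>X\<close>, both sides are viewed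
  for fixed \<open>B\<close> as finite measures in \<open>X\<close> and compared on boxes.\<close>

lemma joint_law_eq:
  assumes fin: "finite A" and v: "0 < v\<^sub>W"
  shows "joint_law \<Omega> n A b M S N
    = (\<Pi>\<^sub>M j\<in>{1..n}. density lborel (\<lambda>x. ennreal (signal_density A (\<lambda>i. b i / sqrt (real n)) v\<^sub>W x)))
      \<Otimes>\<^sub>M message_law \<Omega> A M"
proof -
  let ?\<mu> = "density lborel (\<lambda>x. ennreal (signal_density A (\<lambda>i. b i / sqrt (real n)) v\<^sub>W x))"
  let ?Z = "\<lambda>\<omega>. \<lambda>j\<in>{1..n}. received n A b M S N j \<omega>"
  have \<mu>: "prob_space ?\<mu>"
    using has_integral_signal_density[OF fin v, of "\<lambda>i. b i / sqrt (real n)"]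
    by (intro prob_spaceI)
      (simp add: emeasure_density nn_integral_eq_integral has_bochner_integral_iff signal_density_nonneg)
  interpret \<mu>: prob_space ?\<mu> by fact
  interpret \<mu>n: product_prob_space "\<lambda>_. ?\<mu>" "{1..n}" by standard
  interpret P_M: prob_space "message_law \<Omega> A M"
    unfolding message_law_def by (rule prob_space_distr[OF M_random])
  have sets_\<mu>n: "sets (\<Pi>\<^sub>M j\<in>{1..n}. ?\<mu>) = sets (\<Pi>\<^sub>M j\<in>{1..n}. borel)"
    by (intro sets_PiM_cong) auto
  have Z: "?Z \<in> measurable \<Omega> (\<Pi>\<^sub>M j\<in>{1..n}. borel)"
    using received_random by (intro measurable_restrict) auto
  have ZM: "(\<lambda>\<omega>. (?Z \<omega>, M \<omega>)) \<in> measurable \<Omega> ((\<Pi>\<^sub>M j\<in>{1..n}. borel) \<Otimes>\<^sub>M message_space A)"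
    by (rule measurable_Pair[OF Z M_random])
  have "(\<Pi>\<^sub>M j\<in>{1..n}. ?\<mu>) \<Otimes>\<^sub>M message_law \<Omega> A M = joint_law \<Omega> n A b M S N"
  proof (rule pair_measure_eqI)
    show "sigma_finite_measure (\<Pi>\<^sub>M j\<in>{1..n}. ?\<mu>)" "sigma_finite_measure (message_law \<Omega> A M)"
      by unfold_locales
    show "sets ((\<Pi>\<^sub>M j\<in>{1..n}. ?\<mu>) \<Otimes>\<^sub>M message_law \<Omega> A M) = sets (joint_law \<Omega> n A b M S N)"
      unfolding joint_law_def message_law_def sets_distr
      by (intro sets_pair_measure_cong sets_\<mu>n) simp
    fix X B assume X: "X \<in> sets (\<Pi>\<^sub>M j\<in>{1..n}. ?\<mu>)" and "B \<in> sets (message_law \<Omega> A M)"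
    then have B: "B \<in> sets (message_space A)"
      by (simp add: message_law_def)
    have X': "X \<in> sets (\<Pi>\<^sub>M j\<in>{1..n}. borel)"
      using X unfolding sets_\<mu>n .
    let ?MB = "{\<omega> \<in> space \<Omega>. M \<omega> \<in> B}"
    have MB: "?MB \<in> events"
      using measurable_sets[OF M_random B] by (simp add: vimage_def Int_def conj_commute)
    \<comment> \<open>The output law is restricted to the event that \<open>M\<close> lies in
      \<open>B\<close> rather than conditioned on it, so an event of probability zero needs no
      separate case.\<close>
    define \<nu> where "\<nu> = distr (density \<Omega> (indicator ?MB)) (\<Pi>\<^sub>M j\<in>{1..n}. borel) ?Z"
    have \<nu>: "emeasure \<nu> Y = emeasure \<Omega> {\<omega> \<in> space \<Omega>. M \<omega> \<in> B \<and> ?Z \<omega> \<in> Y}"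
      if Y: "Y \<in> sets (\<Pi>\<^sub>M j\<in>{1..n}. borel)" for Y
    proof -
      have "emeasure \<nu> Y = emeasure (density \<Omega> (indicator ?MB)) (?Z -` Y \<inter> space \<Omega>)"
        unfolding \<nu>_def using Z Y by (subst emeasure_distr) auto
      also have "\<dots> = emeasure \<Omega> (?MB \<inter> (?Z -` Y \<inter> space \<Omega>))"
        using MB measurable_sets[OF Z Y] by (intro emeasure_restricted) auto
      also have "?MB \<inter> (?Z -` Y \<inter> space \<Omega>) = {\<omega> \<in> space \<Omega>. M \<omega> \<in> B \<and> ?Z \<omega> \<in> Y}"
        by auto
      finally show ?thesis .
    qed
    have "\<nu> = scale_measure (emeasure \<Omega> ?MB) (\<Pi>\<^sub>M j\<in>{1..n}. ?\<mu>)"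
    \<comment> \<open>The whole space has finite measure and serves as every member of the
      exhausting sequence.\<close>
    proof (rule measure_eqI_PiM_finite[where I = "{1..n}" and M = "\<lambda>_. borel" and A = "\<lambda>_. (\<Pi>\<^sub>E j\<in>{1..n}. UNIV)"])
      show "sets \<nu> = sets (\<Pi>\<^sub>M j\<in>{1..n}. borel)"
        by (simp add: \<nu>_def)
      show "sets (scale_measure (emeasure \<Omega> ?MB) (\<Pi>\<^sub>M j\<in>{1..n}. ?\<mu>)) = sets (\<Pi>\<^sub>M j\<in>{1..n}. borel)"
        unfolding sets_scale_measure by (fact sets_\<mu>n)
      fix E assume E: "\<And>j. j \<in> {1..n} \<Longrightarrow> E j \<in> sets (borel :: real measure)"
      have "emeasure \<nu> (Pi\<^sub>E {1..n} E) = emeasure \<Omega> {\<omega> \<in> space \<Omega>. M \<omega> \<in> B \<and> ?Z \<omega> \<in> Pi\<^sub>E {1..n} E}"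
        using E by (intro \<nu> sets_PiM_I_finite) auto
      also have "{\<omega> \<in> space \<Omega>. M \<omega> \<in> B \<and> ?Z \<omega> \<in> Pi\<^sub>E {1..n} E}
          = {\<omega> \<in> space \<Omega>. M \<omega> \<in> B \<and> (\<forall>j\<in>{1..n}. received n A b M S N j \<omega> \<in> E j)}"
        by (auto simp: PiE_iff)
      also have "emeasure \<Omega> \<dots> = ennreal (prob ?MB * (\<Prod>j\<in>{1..n}. measure ?\<mu> (E j)))"
        using prob_received[OF fin v B E] by (simp add: emeasure_eq_measure)
      also have "\<dots> = emeasure \<Omega> ?MB * (\<Prod>j\<in>{1..n}. emeasure ?\<mu> (E j))"
        by (simp add: emeasure_eq_measure \<mu>.emeasure_eq_measure ennreal_mult' prod_ennreal prod_nonneg)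
      also have "(\<Prod>j\<in>{1..n}. emeasure ?\<mu> (E j)) = emeasure (\<Pi>\<^sub>M j\<in>{1..n}. ?\<mu>) (Pi\<^sub>E {1..n} E)"
        using E by (intro \<mu>n.emeasure_PiM[symmetric]) auto
      finally show "emeasure \<nu> (Pi\<^sub>E {1..n} E)
          = emeasure (scale_measure (emeasure \<Omega> ?MB) (\<Pi>\<^sub>M j\<in>{1..n}. ?\<mu>)) (Pi\<^sub>E {1..n} E)"
        by simp
    next
      show "emeasure \<nu> (\<Pi>\<^sub>E j\<in>{1..n}. UNIV) \<noteq> \<infinity>"
        using sets.top[of "\<Pi>\<^sub>M j\<in>{1..n}. (borel :: real measure)"]
        by (subst \<nu>) (auto simp: space_PiM)
    qed (auto simp: space_PiM intro!: prod_algebraI_finite)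
    then have "emeasure (\<Pi>\<^sub>M j\<in>{1..n}. ?\<mu>) X * emeasure \<Omega> ?MB = emeasure \<nu> X"
      by (simp add: mult.commute)
    also have "\<dots> = emeasure (joint_law \<Omega> n A b M S N) (X \<times> B)"
    proof -
      have "emeasure (joint_law \<Omega> n A b M S N) (X \<times> B)
          = emeasure \<Omega> ((\<lambda>\<omega>. (?Z \<omega>, M \<omega>)) -` (X \<times> B) \<inter> space \<Omega>)"
        unfolding joint_law_def using X' B by (intro emeasure_distr ZM pair_measureI)
      also have "(\<lambda>\<omega>. (?Z \<omega>, M \<omega>)) -` (X \<times> B) \<inter> space \<Omega> = {\<omega> \<in> space \<Omega>. M \<omega> \<in> B \<and> ?Z \<omega> \<in> X}"
        by auto
      finally show ?thesis
        using \<nu>[OF X'] by simp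
    qed
    finally show "emeasure (\<Pi>\<^sub>M j\<in>{1..n}. ?\<mu>) X * emeasure (message_law \<Omega> A M) B
        = emeasure (joint_law \<Omega> n A b M S N) (X \<times> B)"
      using M_random B by (simp add: message_law_def emeasure_distr vimage_def Int_def conj_commute)
  qed
  then show ?thesis ..
qed

end

section \<open>Covertness\<close>

lemma prob_space_gaussian: "0 < v \<Longrightarrow> prob_space (gaussian v)"
  unfolding gaussian_def by (rule prob_space_normal_density) simp

context willie_channel
begin

text \<open>This makes the set of distances bounded below, so that its real infimum is
  meaningful.\<close>

lemma variational_distance_nonneg:
  assumes "finite A" "0 < v\<^sub>W" "0 < v"
  shows "0 \<le> variational_distance (joint_law \<Omega> n A b M S N) (gaussian_power n v \<Otimes>\<^sub>M message_law \<Omega> A M)"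
proof -
  interpret G: prob_space "gaussian v"
    by (rule prob_space_gaussian) fact
  interpret Gn: product_prob_space "\<lambda>_. gaussian v" "{1..n}" by standard
  interpret P_M: prob_space "message_law \<Omega> A M"
    unfolding message_law_def by (rule prob_space_distr[OF M_random])
  interpret GM: pair_prob_space "gaussian_power n v" "message_law \<Omega> A M"
    unfolding gaussian_power_def by standard
  have Z: "(\<lambda>\<omega>. \<lambda>j\<in>{1..n}. received n A b M S N j \<omega>) \<in> measurable \<Omega> (\<Pi>\<^sub>M j\<in>{1..n}. borel)"
    using received_random by (intro measurable_restrict) auto
  have "prob_space (joint_law \<Omega> n A b M S N)"
    unfolding joint_law_def by (rule prob_space_distr[OF measurable_Pair[OF Z M_random]])
  moreover have "sets (joint_law \<Omega> n A b M S N) = sets (gaussian_power n v \<Otimes>\<^sub>M message_law \<Omega> A M)"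
    unfolding joint_law_def message_law_def gaussian_power_def gaussian_def sets_distr
    by (intro sets_pair_measure_cong sets_PiM_cong) auto
  ultimately show ?thesis
    unfolding variational_distance_def
    using tv_norm_diff_nonneg[OF prob_space.finite_measure GM.finite_measure_axioms] by simp
qed

text \<open>The product form of the joint law reduces the claim to one channel use;
  \<open>1 + x \<le> exp x\<close> then turns the power of the second moment into a single
  exponential.\<close>

lemma variational_distance_le:
  fixes b :: "nat \<Rightarrow> real"
  defines "p\<^sub>2 \<equiv> \<Sum>i\<in>A. (b i / sqrt (real n))\<^sup>2" and "p\<^sub>4 \<equiv> \<Sum>i\<in>A. (b i / sqrt (real n)) ^ 4"
  assumes fin: "finite A" and v: "0 < v\<^sub>W" and small: "p\<^sub>2 \<le> v\<^sub>W / 2"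
  shows "variational_distance (joint_law \<Omega> n A b M S N) (gaussian_power n (v\<^sub>W + p\<^sub>2) \<Otimes>\<^sub>M message_law \<Omega> A M)
    \<le> 1 / 2 * sqrt (exp (real n * (64 * (p\<^sub>2 / v\<^sub>W\<^sup>2)\<^sup>2 * p\<^sub>4)) - 1)"
proof -
  let ?\<beta> = "\<lambda>i. b i / sqrt (real n)"
  let ?q = "normal_density 0 (sqrt (v\<^sub>W + p\<^sub>2))"
  let ?L = "\<lambda>x. signal_density A ?\<beta> v\<^sub>W x / ?q x"
  let ?x = "64 * (p\<^sub>2 / v\<^sub>W\<^sup>2)\<^sup>2 * p\<^sub>4"
  have "0 \<le> p\<^sub>2" "0 \<le> p\<^sub>4"
    unfolding p\<^sub>2_def p\<^sub>4_def by (auto intro!: sum_nonneg)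
  then have "0 < v\<^sub>W + p\<^sub>2" "0 \<le> ?x"
    using v by auto
  interpret P_M: prob_space "message_law \<Omega> A M"
    unfolding message_law_def by (rule prob_space_distr[OF M_random])
  note ratio = signal_density_ratio[OF fin v small[unfolded p\<^sub>2_def], folded p\<^sub>2_def p\<^sub>4_def gaussian_def]
  have "variational_distance (joint_law \<Omega> n A b M S N) (gaussian_power n (v\<^sub>W + p\<^sub>2) \<Otimes>\<^sub>M message_law \<Omega> A M)
      \<le> 1 / 2 * sqrt ((\<integral>x. (?L x)\<^sup>2 \<partial>gaussian (v\<^sub>W + p\<^sub>2)) ^ card {1..n} - 1)"
    unfolding joint_law_eq[OF fin v] gaussian_power_def ratio(1)[symmetric]
  proof (rule variational_distance_power_le)
    show "prob_space (gaussian (v\<^sub>W + p\<^sub>2))"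
      by (rule prob_space_gaussian) fact
    show "?L \<in> borel_measurable (gaussian (v\<^sub>W + p\<^sub>2))"
      unfolding gaussian_def by measurable
  qed (use ratio P_M.prob_space_axioms in \<open>auto simp: signal_density_nonneg\<close>)
  also have "(\<integral>x. (?L x)\<^sup>2 \<partial>gaussian (v\<^sub>W + p\<^sub>2)) ^ card {1..n} \<le> exp ?x ^ n"
    unfolding card_atLeastAtMost diff_Suc_1
    using power_mono[OF order_trans[OF ratio(4) exp_ge_add_one_self], of n] by simp
  also have "exp ?x ^ n = exp (real n * ?x)"
    by (rule exp_of_nat_mult[symmetric])
  finally show ?thesis
    by simp
qed

end

text \<open>The infimum ranges over the positive part of \<open>V\<close> because
  \<open>gaussian v\<close> is the intended law only for positive variances.\<close>

theorem theorem3: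
  fixes \<Omega> :: "nat \<Rightarrow> 'a measure"
    and l :: "nat \<Rightarrow> nat"
    and t :: "nat \<Rightarrow> real"
    and A :: "nat \<Rightarrow> nat set"
    and b :: "nat \<Rightarrow> nat \<Rightarrow> real"
    and b_max b_min v\<^sub>W :: real
    and V :: "real set"
    and M :: "nat \<Rightarrow> 'a \<Rightarrow> nat \<Rightarrow> nat"
    and S :: "nat \<Rightarrow> nat \<Rightarrow> nat \<Rightarrow> 'a \<Rightarrow> nat"
    and N :: "nat \<Rightarrow> nat \<Rightarrow> 'a \<Rightarrow> real"
  assumes "v\<^sub>W > 0"
    and "\<And>n. n \<ge> 1 \<Longrightarrow> willie_channel (\<Omega> n) n (A n) v\<^sub>W (M n) (S n) (N n)"
    and "\<And>n. n \<ge> 1 \<Longrightarrow> finite (A n)"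
    and "\<And>n. n \<ge> 1 \<Longrightarrow> card (A n) = l n"
    and "\<And>n. n \<ge> 1 \<Longrightarrow> t n > 0"
    and "\<And>n. n \<ge> 1 \<Longrightarrow> real (l n) = real n / t n"
    and "(\<lambda>n. real (l n) / real n) \<longlonglongrightarrow> 0"
    and "b_max \<ge> b_min" and "b_min > 0"
    and "\<And>n. n \<ge> 1 \<Longrightarrow> Max (b n ` A n) = b_max"
    and "\<And>n. n \<ge> 1 \<Longrightarrow> Min (b n ` A n) = b_min"
    and "open V" and "v\<^sub>W \<in> V"
  shows "(\<lambda>n. INF v \<in> V \<inter> {0<..}.
            variational_distance (joint_law (\<Omega> n) n (A n) (b n) (M n) (S n) (N n))
              (gaussian_power n v \<Otimes>\<^sub>M message_law (\<Omega> n) (A n) (M n))) \<longlonglongrightarrow> 0"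
proof -
  define d where "d n v = variational_distance (joint_law (\<Omega> n) n (A n) (b n) (M n) (S n) (N n))
    (gaussian_power n v \<Otimes>\<^sub>M message_law (\<Omega> n) (A n) (M n))" for n v
  define \<rho> where "\<rho> n = real (l n) / real n" for n
  have \<rho>: "\<rho> \<longlonglongrightarrow> 0"
    using assms(7) by (simp add: \<rho>_def[abs_def])
  define p\<^sub>2 where "p\<^sub>2 n = (\<Sum>i\<in>A n. (b n i / sqrt (real n))\<^sup>2)" for n
  define p\<^sub>4 where "p\<^sub>4 n = (\<Sum>i\<in>A n. (b n i / sqrt (real n)) ^ 4)" for n
  \<comment> \<open>Obtained from \<open>p\<^sub>2 n \<le> b_max\<^sup>2 * \<rho> n\<close> and
    \<open>p\<^sub>4 n \<le> b_max ^ 4 * \<rho> n / real n\<close>; the division by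
    \<open>real n\<close> cancels the number of channel uses.\<close>
  define u where "u n = 64 * b_max ^ 8 / v\<^sub>W ^ 4 * \<rho> n ^ 3" for n
  have b: "0 \<le> b n i" "b n i \<le> b_max" if "n \<ge> 1" "i \<in> A n" for n i
    using Max_ge[of "b n ` A n" "b n i"] Min_le[of "b n ` A n" "b n i"] assms(3,9,10,11) that by fastforce+
  have p_nonneg: "0 \<le> p\<^sub>2 n" "0 \<le> p\<^sub>4 n" for n
    unfolding p\<^sub>2_def p\<^sub>4_def by (auto intro!: sum_nonneg)
  have p\<^sub>2_le: "p\<^sub>2 n \<le> b_max\<^sup>2 * \<rho> n" if n: "n \<ge> 1" for n
  proof -
    have "p\<^sub>2 n \<le> (\<Sum>i\<in>A n. b_max\<^sup>2 / real n)"
      unfolding p\<^sub>2_def using b[OF n]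
      by (intro sum_mono) (auto simp: power_divide intro!: divide_right_mono power_mono)
    then show ?thesis
      using assms(4)[OF n] by (simp add: \<rho>_def mult.commute)
  qed
  have p\<^sub>4_le: "p\<^sub>4 n \<le> b_max ^ 4 * \<rho> n / real n" if n: "n \<ge> 1" for n
  proof -
    have "sqrt (real n) ^ 4 = (real n)\<^sup>2"
      using power_mult[of "sqrt (real n)" 2 2] by simp
    then have "p\<^sub>4 n \<le> (\<Sum>i\<in>A n. b_max ^ 4 / (real n)\<^sup>2)"
      unfolding p\<^sub>4_def using b[OF n]
      by (intro sum_mono) (auto simp: power_divide intro!: divide_right_mono power_mono)
    then show ?thesis
      using assms(4)[OF n] by (simp add: \<rho>_def power2_eq_square mult.commute)
  qed
  have exponent_le: "real n * (64 * (p\<^sub>2 n / v\<^sub>W\<^sup>2)\<^sup>2 * p\<^sub>4 n) \<le> u n" if n: "n \<ge> 1" for n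
  proof -
    have "(p\<^sub>2 n / v\<^sub>W\<^sup>2)\<^sup>2 \<le> (b_max\<^sup>2 * \<rho> n / v\<^sub>W\<^sup>2)\<^sup>2"
      using p_nonneg p\<^sub>2_le[OF n] by (intro power_mono divide_right_mono) auto
    then have "real n * (64 * (p\<^sub>2 n / v\<^sub>W\<^sup>2)\<^sup>2 * p\<^sub>4 n)
        \<le> real n * (64 * (b_max\<^sup>2 * \<rho> n / v\<^sub>W\<^sup>2)\<^sup>2 * (b_max ^ 4 * \<rho> n / real n))"
      using p_nonneg p\<^sub>4_le[OF n] by (intro mult_left_mono mult_mono) auto
    also have "\<dots> = u n"
      using n assms(1) by (simp add: u_def power_divide power_mult_distrib field_simps flip: power_mult power_add)
        (simp add: eval_nat_numeral)
    finally show ?thesis .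
  qed
  have d_nonneg: "0 \<le> d n v" if "n \<ge> 1" "0 < v" for n v
    unfolding d_def
    by (rule willie_channel.variational_distance_nonneg[OF assms(2) assms(3) assms(1)]) (use that in auto)
  have "p\<^sub>2 \<longlonglongrightarrow> 0"
  proof (rule tendsto_sandwich[OF _ _ tendsto_const])
    show "\<forall>\<^sub>F n in sequentially. p\<^sub>2 n \<le> b_max\<^sup>2 * \<rho> n"
      using p\<^sub>2_le by (auto simp: eventually_at_top_linorder)
    show "(\<lambda>n. b_max\<^sup>2 * \<rho> n) \<longlonglongrightarrow> 0"
      using tendsto_mult_right_zero[OF \<rho>] .
  qed (simp add: p_nonneg)
  then have "(\<lambda>n. v\<^sub>W + p\<^sub>2 n) \<longlonglongrightarrow> v\<^sub>W"
    using tendsto_add[OF tendsto_const[of v\<^sub>W]] by fastforce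
  then have "\<forall>\<^sub>F n in sequentially. v\<^sub>W + p\<^sub>2 n \<in> V"
    using assms(12,13) by (rule topological_tendstoD)
  moreover have "\<forall>\<^sub>F n in sequentially. p\<^sub>2 n < v\<^sub>W / 2"
    using \<open>p\<^sub>2 \<longlonglongrightarrow> 0\<close> assms(1) by (intro order_tendstoD) auto
  ultimately have upper: "\<forall>\<^sub>F n in sequentially. (INF v\<in>V \<inter> {0<..}. d n v) \<le> 1 / 2 * sqrt (exp (u n) - 1)"
    using eventually_ge_at_top[of 1]
  proof eventually_elim
    case (elim n)
    then have n: "n \<ge> 1" by simp
    \<comment> \<open>The variance of equal second moment is an admissible competitor once it lies
      in \<open>V\<close>; \<open>d_nonneg\<close> supplies the lower bound that
      \<open>cINF_lower\<close> needs.\<close>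
    have "(INF v\<in>V \<inter> {0<..}. d n v) \<le> d n (v\<^sub>W + p\<^sub>2 n)"
      using elim p_nonneg[of n] assms(1) d_nonneg[OF n] by (intro cINF_lower bdd_belowI2[of _ 0]) auto
    also have "\<dots> \<le> 1 / 2 * sqrt (exp (real n * (64 * (p\<^sub>2 n / v\<^sub>W\<^sup>2)\<^sup>2 * p\<^sub>4 n)) - 1)"
      unfolding d_def p\<^sub>2_def p\<^sub>4_def
      using elim(2) by (intro willie_channel.variational_distance_le assms(1-3) n) (simp add: p\<^sub>2_def)
    also have "\<dots> \<le> 1 / 2 * sqrt (exp (u n) - 1)"
      using exponent_le[OF n] by simp
    finally show ?case .
  qed
  \<comment> \<open>\<open>cINF_greatest\<close> needs a non-empty index set, and
    \<open>v\<^sub>W\<close> is a member.\<close>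
  have lower: "\<forall>\<^sub>F n in sequentially. 0 \<le> (INF v\<in>V \<inter> {0<..}. d n v)"
    using eventually_ge_at_top[of 1]
  proof eventually_elim
    case (elim n)
    then show ?case
      using assms(1,13) d_nonneg[of n] by (intro cINF_greatest) auto
  qed
  have "u \<longlonglongrightarrow> 64 * b_max ^ 8 / v\<^sub>W ^ 4 * 0 ^ 3"
    unfolding u_def[abs_def] by (intro tendsto_intros \<rho>)
  then have "(\<lambda>n. 1 / 2 * sqrt (exp (u n) - 1)) \<longlonglongrightarrow> 1 / 2 * sqrt (exp (64 * b_max ^ 8 / v\<^sub>W ^ 4 * 0 ^ 3) - 1)"
    by (intro tendsto_intros)
  then have "(\<lambda>n. 1 / 2 * sqrt (exp (u n) - 1)) \<longlonglongrightarrow> 0"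
    by simp
  from tendsto_sandwich[OF lower upper tendsto_const this]
  show ?thesis
    unfolding d_def .
qed

end
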